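(* Let $C$ be any bivariate copula with $\mu_\infty(C)=m$. Then $\rho(C)\in[12m^3-1,\,1-36m^3]$, and any value from this interval can be attained (i.e. for every $m\in[0,\frac13]$ and every $r\in[12m^3-1,1-36m^3]$ there is a copula $C$ with $\mu_\infty(C)=m$ and $\rho(C)=r$). In particular, if $C$ is symmetric (i.e. $C(u,v)=C(v,u)$ for all $u,v$), then $\rho(C)$ can take any value in $[-1,1]$; and if $C$ takes the maximal possible asymmetry $\mu_\infty(C)=\frac13$, then $\rho(C)\in[-\frac59,-\frac13]$.
   Context: For a bivariate copula $C$, the measure of asymmetry is $\mu_\infty(C)=\max_{u,v\in[0,1]}|C(u,v)-C(v,u)|$; its range over all copulas is $[0,\frac13]$. For copulas $C_1,C_2$ the concordance function is $\mathcal{Q}(C_1,C_2)=4\int_{[0,1]^2}C_2(u,v)\,dC_1(u,v)-1$. Spearman's rho is $\rho(C)=3\,\mathcal{Q}(C,\Pi)$, where $\Pi(u,v)=uv$. *)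

theory Defs
  imports "HOL-Analysis.Analysis"
begin

text \<open>
  A copula is represented by a total function on \<open>\<real>\<times>\<real>\<close>; only its values on the unit square
  are constrained, and all notions below depend only on those values.
\<close>

definition copula :: "(real \<Rightarrow> real \<Rightarrow> real) \<Rightarrow> bool" where
  "copula C \<longleftrightarrow>
     (\<forall>u\<in>{0..1}. C u 0 = 0 \<and> C 0 u = 0) \<and>
     (\<forall>u\<in>{0..1}. C u 1 = u \<and> C 1 u = u) \<and>
     (\<forall>u1\<in>{0..1}. \<forall>u2\<in>{0..1}. \<forall>v1\<in>{0..1}. \<forall>v2\<in>{0..1}.
        u1 \<le> u2 \<longrightarrow> v1 \<le> v2 \<longrightarrow> 0 \<le> C u2 v2 - C u2 v1 - C u1 v2 + C u1 v1)"

definition symmetric_copula :: "(real \<Rightarrow> real \<Rightarrow> real) \<Rightarrow> bool" where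
  "symmetric_copula C \<longleftrightarrow> copula C \<and> (\<forall>u\<in>{0..1}. \<forall>v\<in>{0..1}. C u v = C v u)"

text \<open>
  Copulas are continuous, so the supremum below is a maximum.
\<close>

definition mu_inf :: "(real \<Rightarrow> real \<Rightarrow> real) \<Rightarrow> real" where
  "mu_inf C = (SUP (u, v)\<in>{0..1} \<times> {0..1}. \<bar>C u v - C v u\<bar>)"

text \<open>
  The measure \<open>dC\<close>: the Borel measure on the unit square whose distribution function is \<open>C\<close>.
  For a copula it exists (Lebesgue-Stieltjes) and is unique, as the rectangles
  \<open>[0,u] \<times> [0,v]\<close> form an intersection-stable generator.
\<close>

definition copula_measure :: "(real \<Rightarrow> real \<Rightarrow> real) \<Rightarrow> (real \<times> real) measure" where
  "copula_measure C =
     (THE M. sets M = sets (restrict_space borel ({0..1} \<times> {0..1})) \<and>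
        (\<forall>u\<in>{0..1}. \<forall>v\<in>{0..1}. emeasure M ({0..u} \<times> {0..v}) = ennreal (C u v)))"

definition concordance :: "(real \<Rightarrow> real \<Rightarrow> real) \<Rightarrow> (real \<Rightarrow> real \<Rightarrow> real) \<Rightarrow> real" where
  "concordance C1 C2 = 4 * (\<integral>(u, v). C2 u v \<partial>copula_measure C1) - 1"

definition Pi_copula :: "real \<Rightarrow> real \<Rightarrow> real" where
  "Pi_copula u v = u * v"

definition spearman_rho :: "(real \<Rightarrow> real \<Rightarrow> real) \<Rightarrow> real" where
  "spearman_rho C = 3 * concordance C Pi_copula"

end

theory Submission
  imports Defs
begin

text \<open>
  Since \<open>u * v\<close> is the area of \<open>[0,u) \<times> [0,v)\<close>, Fubini turns \<open>\<rho>(C)\<close> into \<open>12 * \<integral>\<integral>C - 3\<close>.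
  A value \<open>d = C(a,b)\<close> forces \<open>C(a,v) \<ge> d - max(0, b - v)\<close>, and the section \<open>h = C(a,\<cdot>)\<close> forces
  \<open>\<integral>C(u,v) du \<ge> v\<^sup>2/2 + h(v) * (1 - a - v + h(v))\<close> because \<open>C(\<cdot>,v)\<close> is increasing and 1-Lipschitz.
  Integrating over \<open>v\<close> gives \<open>\<integral>\<integral>C \<ge> 1/6 + d * e * (d + e)/2\<close> with \<open>e = d + 1 - a - b\<close>; the reflection
  \<open>v - C(1-u,v)\<close> gives the matching upper bound. If \<open>C(a,b) - C(b,a) = m\<close>, then \<open>d, e \<ge> m\<close> at \<open>(a,b)\<close>,
  while for the upper bound at \<open>(b,a)\<close> the two factors are at least \<open>m\<close> and \<open>2 * m\<close>, since also
  \<open>\<bar>a - b\<bar> \<ge> m\<close>. Both bounds are attained by copulas with the same most asymmetric point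
  \<open>((1-m)/2, (1+m)/2)\<close>, so their convex combinations keep \<open>\<mu>\<^sub>\<infinity> = m\<close> and fill the interval.
\<close>

section \<open>Measures on the plane from two-increasing Lipschitz functions\<close>

lemma sum_int_telescope:
  fixes f :: "int \<Rightarrow> real"
  assumes "p \<le> q"
  shows "(\<Sum>i\<in>{p<..q}. f i - f (i - 1)) = f q - f p"
  using assms
proof (induction q rule: int_ge_induct)
  case (step i)
  have "{p<..i + 1} = insert (i + 1) {p<..i}"
    using step.hyps by auto
  then show ?case
    using step.IH by simp
qed simp

lemma sum_UN_le:
  fixes f :: "'a \<Rightarrow> real"
  assumes "finite F" "\<And>k. k \<in> F \<Longrightarrow> finite (A k)" "\<And>x. 0 \<le> f x"
  shows "sum f (\<Union>k\<in>F. A k) \<le> (\<Sum>k\<in>F. sum f (A k))"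
  using assms
proof (induction F rule: finite_induct)
  case (insert k F)
  have "sum f (\<Union>k\<in>insert k F. A k) \<le> sum f (A k) + sum f (\<Union>k\<in>F. A k)"
    using insert.prems insert.hyps sum_nonneg[of "A k \<inter> (\<Union>k\<in>F. A k)" f] by (simp add: sum_Un)
  then show ?case
    using insert by (simp add: order_trans)
qed simp

lemma Ioc_max_right: "{a<..max a b} = {a<..b}" for a b :: "'a :: linorder"
  by (auto simp: max_def split: if_splits)

lemma disjoint_insert4:
  assumes "A \<inter> B = {}" "C \<inter> D = {}" "A \<inter> C = {}" "A \<inter> D = {}" "B \<inter> C = {}" "B \<inter> D = {}"
  shows "disjoint {A, B, C, D}"
  using assms unfolding disjoint_def by blast

lemma Times_Diff_Times: "A \<times> B - A' \<times> B' = (A - A') \<times> B \<union> (A \<inter> A') \<times> (B - B')"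
  by blast

text \<open>Ordered cut points with possibly empty pieces cover every relative position of the two
  intervals. Used in each coordinate, this cuts a difference of boxes into boxes.\<close>

lemma Ioc_Diff_Ioc:
  fixes a b c d :: "'a :: linorder"
  assumes "a \<le> b" "c \<le> d"
  obtains p q where "a \<le> p" "p \<le> q" "q \<le> b"
    "{a<..b} - {c<..d} = {a<..p} \<union> {q<..b}" "{a<..b} \<inter> {c<..d} = {p<..q}"
proof -
  consider "b \<le> c \<or> d \<le> a" | "c < b" "a < d"
    by fastforce
  then show thesis
  proof cases
    case 1
    with assms show thesis
      by (intro that[of b b]) auto
  next
    case 2
    then show thesis
      using assms by (intro that[of "max a c" "min b d"]) (auto simp: le_max_iff_disj min_less_iff_disj)
  qed
qed

text \<open>The Lipschitz bound plays the part of right continuity, in quantitative form. Taking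
  \<open>H\<close> on the whole plane lets boxes be enlarged without boundary cases.\<close>

locale rectangle_content =
  fixes H :: "real \<Rightarrow> real \<Rightarrow> real"
  assumes rect_nonneg:
      "x1 \<le> x2 \<Longrightarrow> y1 \<le> y2 \<Longrightarrow> 0 \<le> H x2 y2 - H x2 y1 - H x1 y2 + H x1 y1"
    and lipschitz: "\<bar>H x y - H x' y'\<bar> \<le> \<bar>x - x'\<bar> + \<bar>y - y'\<bar>"
begin

definition box_of :: "real \<times> real \<times> real \<times> real \<Rightarrow> (real \<times> real) set" where
  "box_of = (\<lambda>(a, b, c, d). {a<..b} \<times> {c<..d})"

definition boxes :: "(real \<times> real \<times> real \<times> real) set" where
  "boxes = {(a, b, c, d). a \<le> b \<and> c \<le> d}"

definition vol :: "real \<times> real \<times> real \<times> real \<Rightarrow> real" where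
  "vol = (\<lambda>(a, b, c, d). H b d - H b c - H a d + H a c)"

lemma vol_nonneg: "R \<in> boxes \<Longrightarrow> 0 \<le> vol R"
  using rect_nonneg by (auto simp: boxes_def vol_def)

text \<open>
  Counting grid points makes volume finitely additive up to rounding of the corners, so finite sub- and
  superadditivity of \<open>vol\<close> follow in the limit without decomposing boxes along a common subdivision.
\<close>

definition grid :: "nat \<Rightarrow> real \<times> real \<times> real \<times> real \<Rightarrow> (int \<times> int) set" where
  "grid n R = {(i, j). (i / Suc n, j / Suc n) \<in> box_of R}"

definition cell :: "nat \<Rightarrow> int \<times> int \<Rightarrow> real" where
  "cell n = (\<lambda>(i, j). vol ((i - 1) / Suc n, i / Suc n, (j - 1) / Suc n, j / Suc n))"

lemma cell_nonneg: "0 \<le> cell n p"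
  unfolding cell_def by (cases p) (auto simp: boxes_def intro!: vol_nonneg divide_right_mono)

text \<open>For an integer \<open>i\<close>, \<open>a < i / Suc n\<close> means that
  \<open>i\<close> exceeds the floor of \<open>a * Suc n\<close>, and
  \<open>i / Suc n \<le> b\<close> that \<open>i\<close> is at most the floor of
  \<open>b * Suc n\<close>.\<close>

lemma grid_eq:
  "grid n (a, b, c, d) =
    {\<lfloor>a * Suc n\<rfloor><..\<lfloor>b * Suc n\<rfloor>} \<times> {\<lfloor>c * Suc n\<rfloor><..\<lfloor>d * Suc n\<rfloor>}"
  by (auto simp: grid_def box_of_def field_simps floor_less_iff le_floor_iff simp del: of_nat_Suc)

lemma finite_grid: "finite (grid n R)"
  by (cases R) (simp add: grid_eq)

text \<open>A cell is a mixed second difference of \<open>H\<close> on the grid, so the sum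
  telescopes in \<open>j\<close> and then in \<open>i\<close>.\<close>

lemma sum_cell_grid:
  fixes a b c d :: real
  assumes "(a, b, c, d) \<in> boxes"
  shows "sum (cell n) (grid n (a, b, c, d)) =
    vol (\<lfloor>a * Suc n\<rfloor> / Suc n, \<lfloor>b * Suc n\<rfloor> / Suc n, \<lfloor>c * Suc n\<rfloor> / Suc n, \<lfloor>d * Suc n\<rfloor> / Suc n)"
proof -
  define F where "F i j = H (real_of_int i / Suc n) (real_of_int j / Suc n)" for i j
  have le: "\<lfloor>a * Suc n\<rfloor> \<le> \<lfloor>b * Suc n\<rfloor>" "\<lfloor>c * Suc n\<rfloor> \<le> \<lfloor>d * Suc n\<rfloor>"
    using assms by (auto simp: boxes_def simp del: of_nat_Suc intro!: floor_mono mult_right_mono)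
  have "sum (cell n) (grid n (a, b, c, d)) =
    (\<Sum>i\<in>{\<lfloor>a * Suc n\<rfloor><..\<lfloor>b * Suc n\<rfloor>}. \<Sum>j\<in>{\<lfloor>c * Suc n\<rfloor><..\<lfloor>d * Suc n\<rfloor>}.
       (F i j - F (i - 1) j) - (F i (j - 1) - F (i - 1) (j - 1)))"
    unfolding grid_eq sum.cartesian_product
    by (intro sum.cong) (auto simp: cell_def vol_def F_def)
  also have "\<dots> = (\<Sum>i\<in>{\<lfloor>a * Suc n\<rfloor><..\<lfloor>b * Suc n\<rfloor>}.
       (F i \<lfloor>d * Suc n\<rfloor> - F i \<lfloor>c * Suc n\<rfloor>) - (F (i - 1) \<lfloor>d * Suc n\<rfloor> - F (i - 1) \<lfloor>c * Suc n\<rfloor>))"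
    using sum_int_telescope[OF le(2), of "\<lambda>j. F i j - F (i - 1) j" for i]
    by (intro sum.cong) simp_all
  also have "\<dots> = (F \<lfloor>b * Suc n\<rfloor> \<lfloor>d * Suc n\<rfloor> - F \<lfloor>b * Suc n\<rfloor> \<lfloor>c * Suc n\<rfloor>) -
      (F \<lfloor>a * Suc n\<rfloor> \<lfloor>d * Suc n\<rfloor> - F \<lfloor>a * Suc n\<rfloor> \<lfloor>c * Suc n\<rfloor>)"
    by (rule sum_int_telescope[OF le(1)])
  finally show ?thesis
    by (simp add: vol_def F_def)
qed

lemma tendsto_grid_point: "(\<lambda>n. \<lfloor>x * Suc n\<rfloor> / Suc n) \<longlonglongrightarrow> x" for x :: real
proof (rule LIM_zero_cancel, rule Lim_null_comparison)
  have "norm (\<lfloor>x * Suc n\<rfloor> / Suc n - x) \<le> inverse (Suc n)" for n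
  proof -
    have "\<lfloor>x * Suc n\<rfloor> / Suc n - x = (\<lfloor>x * Suc n\<rfloor> - x * Suc n) / Suc n"
      by (simp add: diff_divide_distrib del: of_nat_Suc)
    also have "norm \<dots> = \<bar>\<lfloor>x * Suc n\<rfloor> - x * Suc n\<bar> / Suc n"
      by simp
    also have "\<dots> \<le> 1 / Suc n"
      by (intro divide_right_mono) linarith+
    finally show ?thesis
      by (simp add: inverse_eq_divide)
  qed
  then show "\<forall>\<^sub>F n in sequentially. norm (\<lfloor>x * Suc n\<rfloor> / Suc n - x) \<le> inverse (Suc n)"
    by simp
qed (rule LIMSEQ_inverse_real_of_nat)

lemma tendsto_H:
  assumes "f \<longlonglongrightarrow> x" "g \<longlonglongrightarrow> y"
  shows "(\<lambda>n. H (f n) (g n)) \<longlonglongrightarrow> H x y"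
proof (rule LIM_zero_cancel, rule Lim_null_comparison)
  show "\<forall>\<^sub>F n in sequentially. norm (H (f n) (g n) - H x y) \<le> \<bar>f n - x\<bar> + \<bar>g n - y\<bar>"
    by (simp add: lipschitz)
  show "(\<lambda>n. \<bar>f n - x\<bar> + \<bar>g n - y\<bar>) \<longlonglongrightarrow> 0"
    using assms by (auto intro!: tendsto_add_zero tendsto_rabs_zero LIM_zero)
qed

lemma tendsto_sum_cell:
  assumes "R \<in> boxes"
  shows "(\<lambda>n. sum (cell n) (grid n R)) \<longlonglongrightarrow> vol R"
proof -
  obtain a b c d where R: "R = (a, b, c, d)"
    by (cases R)
  show ?thesis
    using assms unfolding R sum_cell_grid[OF assms[unfolded R]] unfolding vol_def prod.case
    by (intro tendsto_intros tendsto_H tendsto_grid_point)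
qed

lemma vol_le_sum:
  assumes "R \<in> boxes" "finite F" "\<And>k. k \<in> F \<Longrightarrow> S k \<in> boxes" "box_of R \<subseteq> (\<Union>k\<in>F. box_of (S k))"
  shows "vol R \<le> (\<Sum>k\<in>F. vol (S k))"
proof (rule LIMSEQ_le)
  show "(\<lambda>n. sum (cell n) (grid n R)) \<longlonglongrightarrow> vol R"
    by (rule tendsto_sum_cell) fact
  show "(\<lambda>n. \<Sum>k\<in>F. sum (cell n) (grid n (S k))) \<longlonglongrightarrow> (\<Sum>k\<in>F. vol (S k))"
    by (intro tendsto_sum tendsto_sum_cell assms)
  have "sum (cell n) (grid n R) \<le> (\<Sum>k\<in>F. sum (cell n) (grid n (S k)))" for n
  proof -
    have "sum (cell n) (grid n R) \<le> sum (cell n) (\<Union>k\<in>F. grid n (S k))"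
      using assms(4) by (intro sum_mono2 finite_UN_I finite_grid assms(2) cell_nonneg)
        (force simp: grid_def)
    also have "\<dots> \<le> (\<Sum>k\<in>F. sum (cell n) (grid n (S k)))"
      by (intro sum_UN_le assms(2) finite_grid cell_nonneg)
    finally show ?thesis .
  qed
  then show "\<exists>N. \<forall>n\<ge>N. sum (cell n) (grid n R) \<le> (\<Sum>k\<in>F. sum (cell n) (grid n (S k)))"
    by blast
qed

lemma sum_vol_le:
  assumes "R \<in> boxes" "finite F" "\<And>k. k \<in> F \<Longrightarrow> S k \<in> boxes" "\<And>k. k \<in> F \<Longrightarrow> box_of (S k) \<subseteq> box_of R"
    "disjoint_family_on (\<lambda>k. box_of (S k)) F"
  shows "(\<Sum>k\<in>F. vol (S k)) \<le> vol R"
proof (rule LIMSEQ_le)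
  show "(\<lambda>n. sum (cell n) (grid n R)) \<longlonglongrightarrow> vol R"
    by (rule tendsto_sum_cell) fact
  show "(\<lambda>n. \<Sum>k\<in>F. sum (cell n) (grid n (S k))) \<longlonglongrightarrow> (\<Sum>k\<in>F. vol (S k))"
    by (intro tendsto_sum tendsto_sum_cell assms)
  have "(\<Sum>k\<in>F. sum (cell n) (grid n (S k))) \<le> sum (cell n) (grid n R)" for n
  proof -
    have "(\<Sum>k\<in>F. sum (cell n) (grid n (S k))) = sum (cell n) (\<Union>k\<in>F. grid n (S k))"
      using assms(2,5) by (intro sum.UNION_disjoint[symmetric] ballI finite_grid)
        (auto simp: grid_def disjoint_family_on_def)
    also have "\<dots> \<le> sum (cell n) (grid n R)"
      using assms(4) by (intro sum_mono2 finite_grid cell_nonneg) (force simp: grid_def)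
    finally show ?thesis .
  qed
  then show "\<exists>N. \<forall>n\<ge>N. (\<Sum>k\<in>F. sum (cell n) (grid n (S k))) \<le> sum (cell n) (grid n R)"
    by blast
qed

section \<open>Monotonicity and countable additivity of box volumes\<close>

lemma vol_mono:
  assumes "R \<in> boxes" "S \<in> boxes" "box_of R \<subseteq> box_of S"
  shows "vol R \<le> vol S"
  using vol_le_sum[of R "{()}" "\<lambda>_. S"] assms by simp

text \<open>Moving one corner of the box changes three of the four values of \<open>H\<close>: one
  by at most \<open>2 * \<delta>\<close>, the other two by at most \<open>\<delta>\<close>
  each.\<close>

lemma vol_grow:
  assumes "0 \<le> \<delta>"
  shows "vol (a, b + \<delta>, c, d + \<delta>) \<le> vol (a, b, c, d) + 4 * \<delta>"
    and "vol (a, b, c, d) \<le> vol (a + \<delta>, b, c + \<delta>, d) + 4 * \<delta>"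
  using lipschitz[of "b + \<delta>" "d + \<delta>" b d] lipschitz[of "b + \<delta>" c b c] lipschitz[of a "d + \<delta>" a d]
    lipschitz[of "a + \<delta>" "c + \<delta>" a c] lipschitz[of b "c + \<delta>" b c] lipschitz[of "a + \<delta>" d a d] assms
  by (simp_all add: vol_def)

text \<open>Compactness: \<open>R\<close> is shrunk to a closed box, each \<open>S k\<close> is
  enlarged to an open one, and a finite subcover reduces the claim to
  \<open>vol_le_sum\<close>.\<close>

lemma vol_le_suminf:
  assumes R: "R \<in> boxes" and S: "\<And>k::nat. S k \<in> boxes" and cover: "box_of R \<subseteq> (\<Union>k. box_of (S k))"
    and summable: "summable (\<lambda>k. vol (S k))"
  shows "vol R \<le> (\<Sum>k. vol (S k))"
proof (rule field_le_epsilon)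
  fix e :: real assume "0 < e"
  obtain a b c d where R': "R = (a, b, c, d)"
    by (cases R)
  obtain A B C D where S': "\<And>k. S k = (A k, B k, C k, D k)"
    by (rule that[of "\<lambda>k. fst (S k)" "\<lambda>k. fst (snd (S k))"
          "\<lambda>k. fst (snd (snd (S k)))" "\<lambda>k. snd (snd (snd (S k)))"]) simp
  have S_le: "A k \<le> B k" "C k \<le> D k" for k
    using S[of k] by (auto simp: boxes_def S')
  show "vol R \<le> (\<Sum>k. vol (S k)) + e"
  proof (cases "a < b \<and> c < d")
    case False
    then have "vol R = 0"
      using R by (auto simp: vol_def R' boxes_def)
    then show ?thesis
      using suminf_nonneg[OF summable vol_nonneg[OF S]] \<open>0 < e\<close> by simp
  next
    case True
    \<comment> \<open>Shrinking by at most the side lengths keeps the box in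
      \<open>boxes\<close>.\<close>
    define \<eta> where "\<eta> = min (e / 8) (min (b - a) (d - c))"
    have \<eta>: "0 < \<eta>" "\<eta> \<le> e / 8" "\<eta> \<le> b - a" "\<eta> \<le> d - c"
      using True \<open>0 < e\<close> unfolding \<eta>_def by (simp, linarith+)
    \<comment> \<open>The enlargements sum to \<open>e / 8\<close>, so they cost at most
      \<open>e / 2\<close> in total by \<open>vol_grow\<close>; shrinking by \<open>\<eta>\<close>
      costs at most another \<open>e / 2\<close>.\<close>
    define \<delta> where "\<delta> k = e / 8 * (1 / 2) ^ Suc k" for k
    have \<delta>_pos: "0 < \<delta> k" for k
      using \<open>0 < e\<close> by (simp add: \<delta>_def)
    have \<delta>_sums: "\<delta> sums (e / 8)"
      using sums_mult[OF power_half_series, of "e / 8"] unfolding \<delta>_def by simp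
    define S2 where "S2 k = (A k, B k + \<delta> k, C k, D k + \<delta> k)" for k
    have comp: "compact ({a + \<eta>..b} \<times> {c + \<eta>..d})"
      by (intro compact_Times compact_Icc)
    have cov: "{a + \<eta>..b} \<times> {c + \<eta>..d} \<subseteq> (\<Union>k. {A k<..<B k + \<delta> k} \<times> {C k<..<D k + \<delta> k})"
    proof safe
      fix x y assume "x \<in> {a + \<eta>..b}" "y \<in> {c + \<eta>..d}"
      then have "(x, y) \<in> box_of R"
        using \<eta> by (auto simp: box_of_def R')
      then obtain k where "(x, y) \<in> box_of (S k)"
        using cover by blast
      then show "(x, y) \<in> (\<Union>k. {A k<..<B k + \<delta> k} \<times> {C k<..<D k + \<delta> k})"
        using \<delta>_pos[of k] by (intro UN_I[of k]) (auto simp: box_of_def S')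
    qed
    have op: "open ({A k<..<B k + \<delta> k} \<times> {C k<..<D k + \<delta> k})" for k
      by (intro open_Times open_greaterThanLessThan)
    obtain F where F: "finite F"
      "{a + \<eta>..b} \<times> {c + \<eta>..d} \<subseteq> (\<Union>k\<in>F. {A k<..<B k + \<delta> k} \<times> {C k<..<D k + \<delta> k})"
      by (rule compactE_image[OF comp op cov])
    have "vol R \<le> vol (a + \<eta>, b, c + \<eta>, d) + 4 * \<eta>"
      using \<eta> unfolding R' by (intro vol_grow) auto
    also have "vol (a + \<eta>, b, c + \<eta>, d) \<le> (\<Sum>k\<in>F. vol (S2 k))"
    proof (rule vol_le_sum)
      have "box_of (a + \<eta>, b, c + \<eta>, d) \<subseteq> {a + \<eta>..b} \<times> {c + \<eta>..d}"
        by (auto simp: box_of_def)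
      also note F(2)
      also have "(\<Union>k\<in>F. {A k<..<B k + \<delta> k} \<times> {C k<..<D k + \<delta> k}) \<subseteq> (\<Union>k\<in>F. box_of (S2 k))"
        by (force simp: box_of_def S2_def)
      finally show "box_of (a + \<eta>, b, c + \<eta>, d) \<subseteq> (\<Union>k\<in>F. box_of (S2 k))" .
      show "S2 k \<in> boxes" for k
        using S_le[of k] \<delta>_pos[of k] by (simp add: S2_def boxes_def)
    qed (use F \<eta> in \<open>auto simp: boxes_def\<close>)
    also have "(\<Sum>k\<in>F. vol (S2 k)) \<le> (\<Sum>k\<in>F. vol (S k) + 4 * \<delta> k)"
      using \<delta>_pos unfolding S2_def S' by (intro sum_mono vol_grow less_imp_le)
    also have "\<dots> \<le> (\<Sum>k. vol (S k) + 4 * \<delta> k)"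
      using summable \<delta>_sums vol_nonneg[OF S] \<delta>_pos F(1)
      by (intro sum_le_suminf summable_add summable_mult)
        (auto simp: sums_iff less_imp_le intro!: add_nonneg_nonneg)
    also have "\<dots> = (\<Sum>k. vol (S k)) + 4 * (e / 8)"
      using summable \<delta>_sums
      by (subst suminf_add[symmetric]) (auto simp: sums_iff suminf_mult intro: summable_mult)
    finally show ?thesis
      using \<eta>(2) by simp
  qed
qed

text \<open>Finite superadditivity bounds the partial sums by \<open>vol R\<close>, which gives
  summability and one inequality; the covering bound gives the other.\<close>

lemma suminf_vol:
  assumes R: "R \<in> boxes" and S: "\<And>k::nat. S k \<in> boxes" and disj: "disjoint_family (\<lambda>k. box_of (S k))"
    and union: "(\<Union>k. box_of (S k)) = box_of R"
  shows "(\<Sum>k. ennreal (vol (S k))) = ennreal (vol R)"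
proof -
  have partial: "(\<Sum>k<n. vol (S k)) \<le> vol R" for n
    using disj union by (intro sum_vol_le R S) (auto simp: disjoint_family_on_def)
  have summable: "summable (\<lambda>k. vol (S k))"
    by (rule summableI_nonneg_bounded[OF vol_nonneg[OF S] partial])
  have "(\<Sum>k. vol (S k)) = vol R"
    using union by (intro antisym suminf_le_const summable partial vol_le_suminf R S) auto
  then show ?thesis
    using summable vol_nonneg[OF S] by (simp add: suminf_ennreal2)
qed

section \<open>The semiring of boxes and Caratheodory extension\<close>

lemma box_of_Int:
  assumes "R \<in> boxes" "S \<in> boxes"
  shows "box_of R \<inter> box_of S \<in> box_of ` boxes"
proof -
  obtain a b c d where R: "R = (a, b, c, d)" "a \<le> b" "c \<le> d"
    using assms by (auto simp: boxes_def)
  obtain a' b' c' d' where S: "S = (a', b', c', d')" "a' \<le> b'" "c' \<le> d'"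
    using assms by (auto simp: boxes_def)
  \<comment> \<open>The outer \<open>max\<close> keeps upper endpoints above lower ones, so an empty
    intersection is still described by an element of \<open>boxes\<close>.\<close>
  let ?T = "(max a a', max (max a a') (min b b'), max c c', max (max c c') (min d d'))"
  have "box_of R \<inter> box_of S = box_of ?T"
    unfolding R S box_of_def prod.case Times_Int_Times Int_greaterThanAtMost Ioc_max_right ..
  moreover have "?T \<in> boxes"
    by (simp add: boxes_def le_max_iff_disj)
  ultimately show ?thesis
    by blast
qed

lemma box_of_Diff:
  assumes "R \<in> boxes" "S \<in> boxes"
  shows "\<exists>\<C>\<subseteq>box_of ` boxes. finite \<C> \<and> disjoint \<C> \<and> box_of R - box_of S = \<Union>\<C>"
proof -
  obtain a b c d where R: "R = (a, b, c, d)" "a \<le> b" "c \<le> d"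
    using assms by (auto simp: boxes_def)
  obtain a' b' c' d' where S: "S = (a', b', c', d')" "a' \<le> b'" "c' \<le> d'"
    using assms by (auto simp: boxes_def)
  obtain p q where pq: "a \<le> p" "p \<le> q" "q \<le> b"
    "{a<..b} - {a'<..b'} = {a<..p} \<union> {q<..b}" "{a<..b} \<inter> {a'<..b'} = {p<..q}"
    by (rule Ioc_Diff_Ioc[OF R(2) S(2)])
  obtain r s where rs: "c \<le> r" "r \<le> s" "s \<le> d"
    "{c<..d} - {c'<..d'} = {c<..r} \<union> {s<..d}"
    by (rule Ioc_Diff_Ioc[OF R(3) S(3)])
  \<comment> \<open>Left and right strips of full height, then the parts of the middle column below
    and above the removed box.\<close>
  let ?C = "{box_of (a, p, c, d), box_of (q, b, c, d), box_of (p, q, c, r), box_of (p, q, s, d)}"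
  have "?C \<subseteq> box_of ` boxes"
    using pq(1-3) rs(1-3) R by (intro insert_subsetI imageI empty_subsetI) (simp_all add: boxes_def)
  moreover have "disjoint ?C"
  proof (rule disjoint_insert4)
    show "box_of (a, p, c, d) \<inter> box_of (q, b, c, d) = {}" "box_of (p, q, c, r) \<inter> box_of (p, q, s, d) = {}"
      using pq(2) rs(2) by (auto simp: box_of_def simp del: Int_greaterThanAtMost)
  qed (auto simp: box_of_def simp del: Int_greaterThanAtMost)
  moreover have "box_of R - box_of S = \<Union>?C"
  proof -
    have "box_of R - box_of S = ({a<..b} - {a'<..b'}) \<times> {c<..d} \<union>
        ({a<..b} \<inter> {a'<..b'}) \<times> ({c<..d} - {c'<..d'})"
      unfolding R(1) S(1) box_of_def prod.case by (rule Times_Diff_Times)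
    also have "\<dots> = \<Union>?C"
      by (simp only: pq(4,5) rs(4) box_of_def prod.case Union_insert Union_empty Un_empty_right
          Sigma_Un_distrib1 Sigma_Un_distrib2 Times_Un_distrib1 Un_assoc)
    finally show ?thesis .
  qed
  ultimately show ?thesis
    by blast
qed

lemma semiring_boxes: "semiring_of_sets UNIV (box_of ` boxes)"
proof
  show "{} \<in> box_of ` boxes"
    by (rule image_eqI[of _ _ "(0, 0, 0, 0)"]) (auto simp: box_of_def boxes_def)
qed (use box_of_Int box_of_Diff in auto)

lemma exists_measure:
  "\<exists>M. sets M = sets borel \<and> (\<forall>a b c d. a \<le> b \<longrightarrow> c \<le> d \<longrightarrow>
      emeasure M ({a<..b} \<times> {c<..d}) = ennreal (H b d - H b c - H a d + H a c))"
proof (intro exI conjI allI impI)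
  define M where "M = extend_measure UNIV boxes box_of (\<lambda>R. ennreal (vol R))"
  have eq: "emeasure M (box_of R) = ennreal (vol R)" if "R \<in> boxes" for R
  proof (rule extend_measure_caratheodory[OF M_def that semiring_boxes])
    show "ennreal (vol R) = 0" if "R \<in> boxes" "box_of R = {}" for R
      using vol_mono[of R "(0, 0, 0, 0)"] vol_nonneg[of R] that
      by (simp add: boxes_def) (simp add: vol_def)
    \<comment> \<open>All empty boxes are the same set, so \<open>vol\<close> has to be shown to
      depend on the set alone.\<close>
    show "ennreal (vol R) = ennreal (vol S)" if "R \<in> boxes" "S \<in> boxes" "box_of R = box_of S" for R S
      using vol_mono[of R S] vol_mono[of S R] that by simp
    show "(\<Sum>n. ennreal (vol (S n))) = ennreal (vol R)"
      if "S \<in> UNIV \<rightarrow> boxes" "R \<in> boxes" "disjoint_family (box_of \<circ> S)" "(\<Union>k. box_of (S k)) = box_of R" for S R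
      using that by (intro suminf_vol) (auto simp: comp_def)
  qed simp
  show "emeasure M ({a<..b} \<times> {c<..d}) = ennreal (H b d - H b c - H a d + H a c)"
    if "a \<le> b" "c \<le> d" for a b c d
    using eq[of "(a, b, c, d)"] that by (simp add: boxes_def box_of_def vol_def)
  have "sets M = sigma_sets UNIV (box_of ` boxes)"
    unfolding M_def by (subst sets_extend_measure) auto
  also have "\<dots> = sets (sigma UNIV (box_of ` boxes))"
    by simp
  also have "sigma UNIV (box_of ` boxes) = borel"
  proof (rule sym, rule borel_eq_sigmaI1[OF borel_eq_atMost])
    fix P :: "(real \<times> real) set"
    assume "P \<in> range atMost"
    then obtain p where P: "P = {..p}"
      by blast
    obtain x y where p: "p = (x, y)"
      by (cases p)
    \<comment> \<open>Quadrants generate the Borel sets. The \<open>min\<close> keeps the lower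
      corner below \<open>(x, y)\<close> for every \<open>n\<close>.\<close>
    have "{..p} = (\<Union>n::nat. box_of (min x (- real n), x, min y (- real n), y))"
    proof (intro equalityI subsetI)
      fix q assume "q \<in> {..p}"
      then obtain s t where q: "q = (s, t)" "s \<le> x" "t \<le> y"
        by (cases q) (auto simp: p)
      obtain n :: nat where "max (-s) (-t) < n"
        using reals_Archimedean2 by blast
      then show "q \<in> (\<Union>n::nat. box_of (min x (- real n), x, min y (- real n), y))"
        using q by (intro UN_I[of n]) (auto simp: box_of_def)
    qed (auto simp: box_of_def p)
    moreover have "box_of (min x (- real n), x, min y (- real n), y) \<in> box_of ` boxes" for n
      by (intro imageI) (simp add: boxes_def)
    then have "(\<Union>n::nat. box_of (min x (- real n), x, min y (- real n), y)) \<in> sigma_sets UNIV (box_of ` boxes)"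
      by (intro sigma_sets.Union sigma_sets.Basic)
    ultimately show "P \<in> sets (sigma UNIV (box_of ` boxes))"
      by (simp add: P)
  next
    show "box_of R \<in> sets borel" for R
      by (cases R) (auto simp: box_of_def intro!: borel_Times)
  qed
  finally show "sets M = sets borel" .
qed

end

section \<open>The measure of a copula\<close>

lemma copula_bottom: "copula C \<Longrightarrow> u \<in> {0..1} \<Longrightarrow> C u 0 = 0"
  and copula_left: "copula C \<Longrightarrow> u \<in> {0..1} \<Longrightarrow> C 0 u = 0"
  and copula_top: "copula C \<Longrightarrow> u \<in> {0..1} \<Longrightarrow> C u 1 = u"
  and copula_right: "copula C \<Longrightarrow> u \<in> {0..1} \<Longrightarrow> C 1 u = u"
  by (simp_all add: copula_def)

lemma copula_rect:
  assumes "copula C" "0 \<le> u1" "u1 \<le> u2" "u2 \<le> 1" "0 \<le> v1" "v1 \<le> v2" "v2 \<le> 1"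
  shows "0 \<le> C u2 v2 - C u2 v1 - C u1 v2 + C u1 v1"
  using assms unfolding copula_def by simp

text \<open>Carries facts about the first argument over to the second.\<close>

lemma copula_transpose:
  assumes "copula C"
  shows "copula (\<lambda>u v. C v u)"
  unfolding copula_def
proof (intro conjI ballI impI)
  fix u1 u2 v1 v2 :: real
  assume "u1 \<in> {0..1}" "u2 \<in> {0..1}" "v1 \<in> {0..1}" "v2 \<in> {0..1}" "u1 \<le> u2" "v1 \<le> v2"
  then show "0 \<le> C v2 u2 - C v1 u2 - C v2 u1 + C v1 u1"
    using copula_rect[OF assms, of v1 v2 u1 u2] by simp
qed (use assms in \<open>auto simp: copula_def\<close>)

text \<open>The rectangle inequality on \<open>[u, u'] \<times> [0, v]\<close>, where the lower edge
  contributes 0. The rectangle \<open>[u, u'] \<times> [v, 1]\<close> gives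
  \<open>copula_diff1\<close> in the same way.\<close>

lemma copula_mono1:
  assumes "copula C" "0 \<le> u" "u \<le> u'" "u' \<le> 1" "0 \<le> v" "v \<le> 1"
  shows "C u v \<le> C u' v"
  using copula_rect[of C u u' 0 v] copula_bottom[of C u] copula_bottom[of C u'] assms by simp

lemma copula_diff1:
  assumes "copula C" "0 \<le> u" "u \<le> u'" "u' \<le> 1" "0 \<le> v" "v \<le> 1"
  shows "C u' v - C u v \<le> u' - u"
  using copula_rect[of C u u' v 1] copula_top[of C u] copula_top[of C u'] assms by simp

lemma copula_mono2:
  assumes "copula C" "0 \<le> u" "u \<le> 1" "0 \<le> v" "v \<le> v'" "v' \<le> 1"
  shows "C u v \<le> C u v'"
  using copula_mono1[OF copula_transpose[OF assms(1)]] assms by simp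

lemma copula_diff2:
  assumes "copula C" "0 \<le> u" "u \<le> 1" "0 \<le> v" "v \<le> v'" "v' \<le> 1"
  shows "C u v' - C u v \<le> v' - v"
  using copula_diff1[OF copula_transpose[OF assms(1)]] assms by simp

lemma copula_bounds:
  assumes "copula C" "0 \<le> u" "u \<le> 1" "0 \<le> v" "v \<le> 1"
  shows "0 \<le> C u v" "C u v \<le> u" "C u v \<le> v" "u + v - 1 \<le> C u v"
  using copula_mono1[of C 0 u v] copula_mono1[of C u 1 v] copula_mono2[of C u v 1]
    copula_diff1[of C u 1 v] copula_left[of C v] copula_right[of C v] copula_top[of C u] assms by auto

lemma copula_lipschitz:
  assumes "copula C" "u \<in> {0..1}" "u' \<in> {0..1}" "v \<in> {0..1}" "v' \<in> {0..1}"
  shows "\<bar>C u v - C u' v'\<bar> \<le> \<bar>u - u'\<bar> + \<bar>v - v'\<bar>"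
proof -
  have "\<bar>C u v - C u' v\<bar> \<le> \<bar>u - u'\<bar>"
    using assms copula_mono1[of C u u' v] copula_mono1[of C u' u v] copula_diff1[of C u u' v]
      copula_diff1[of C u' u v] by (cases "u \<le> u'") auto
  moreover have "\<bar>C u' v - C u' v'\<bar> \<le> \<bar>v - v'\<bar>"
    using assms copula_mono2[of C u' v v'] copula_mono2[of C u' v' v] copula_diff2[of C u' v v']
      copula_diff2[of C u' v' v] by (cases "v \<le> v'") auto
  ultimately show ?thesis
    by linarith
qed

lemma continuous_on_copula:
  assumes "copula C"
  shows "continuous_on ({0..1} \<times> {0..1}) (\<lambda>(u, v). C u v)"
proof (rule continuous_onI)
  fix p :: "real \<times> real" and e :: real
  assume p: "p \<in> {0..1} \<times> {0..1}" and "0 < e"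
  have "dist (case q of (u, v) \<Rightarrow> C u v) (case p of (u, v) \<Rightarrow> C u v) \<le> e"
    if "q \<in> {0..1} \<times> {0..1}" "dist q p < e / 2" for q
  proof -
    have "dist (case q of (u, v) \<Rightarrow> C u v) (case p of (u, v) \<Rightarrow> C u v) \<le>
        dist (fst q) (fst p) + dist (snd q) (snd p)"
      using copula_lipschitz[OF assms, of "fst q" "fst p" "snd q" "snd p"] p that
      by (auto simp: dist_real_def split_beta mem_Times_iff)
    also have "\<dots> \<le> dist q p + dist q p"
      by (intro add_mono dist_fst_le dist_snd_le)
    finally show ?thesis
      using that by simp
  qed
  then show "\<exists>d>0. \<forall>q\<in>{0..1} \<times> {0..1}. dist q p < d \<longrightarrow>
      dist (case q of (u, v) \<Rightarrow> C u v) (case p of (u, v) \<Rightarrow> C u v) \<le> e"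
    using \<open>0 < e\<close> by (intro exI[of _ "e / 2"]) auto
qed

lemma continuous_on_copula_slice:
  assumes "copula C" "v \<in> {0..1}"
  shows "continuous_on {0..1} (\<lambda>u. C u v)"
proof -
  have "continuous_on {0..1} (\<lambda>u. (u, v))"
    by (intro continuous_intros)
  from continuous_on_compose2[OF continuous_on_copula[OF assms(1)] this] show ?thesis
    using assms(2) by (simp add: image_subset_iff)
qed

text \<open>Iterated with \<open>v\<close> outside, because the later estimates bound each slice in
  \<open>u\<close> first and then integrate over \<open>v\<close>.\<close>

definition double_integral :: "(real \<Rightarrow> real \<Rightarrow> real) \<Rightarrow> real" where
  "double_integral C = integral {0..1} (\<lambda>v. integral {0..1} (\<lambda>u. C u v))"

lemma continuous_on_slice_integral:
  assumes "copula C"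
  shows "continuous_on {0..1} (\<lambda>v. integral {0..1} (\<lambda>u. C u v))"
proof -
  have "continuous_on ({0..1} \<times> cbox 0 1) (\<lambda>(v, u). C u v)"
    using continuous_on_copula[OF copula_transpose[OF assms]] by (simp add: cbox_interval)
  from integral_continuous_on_param[OF this] show ?thesis
    by (simp add: cbox_interval)
qed

text \<open>Projection to the unit interval is monotone and 1-Lipschitz, so composing with it
  extends a copula to the plane and keeps both properties of
  \<open>rectangle_content\<close>.\<close>

definition clip :: "real \<Rightarrow> real" where
  "clip x = max 0 (min 1 x)"

lemma clip_mem: "clip x \<in> {0..1}"
  by (auto simp: clip_def)

lemma clip_id: "x \<in> {0..1} \<Longrightarrow> clip x = x"
  by (auto simp: clip_def)

lemma clip_mono: "x \<le> y \<Longrightarrow> clip x \<le> clip y"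
  by (auto simp: clip_def)

lemma copula_rectangle_content:
  assumes "copula C"
  shows "rectangle_content (\<lambda>x y. C (clip x) (clip y))"
proof
  show "0 \<le> C (clip x2) (clip y2) - C (clip x2) (clip y1) - C (clip x1) (clip y2) + C (clip x1) (clip y1)"
    if "x1 \<le> x2" "y1 \<le> y2" for x1 x2 y1 y2
    using copula_rect[OF assms, of "clip x1" "clip x2" "clip y1" "clip y2"] clip_mem clip_mono that by auto
  show "\<bar>C (clip x) (clip y) - C (clip x') (clip y')\<bar> \<le> \<bar>x - x'\<bar> + \<bar>y - y'\<bar>" for x y x' y'
  proof -
    have "\<bar>clip s - clip t\<bar> \<le> \<bar>s - t\<bar>" for s t
      by (auto simp: clip_def max_def min_def)
    then show ?thesis
      using copula_lipschitz[OF assms clip_mem clip_mem clip_mem clip_mem, of x y x' y'] by (smt (verit))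
  qed
qed

section \<open>Existence and uniqueness of the copula measure\<close>

abbreviation unit_square :: "(real \<times> real) set" where
  "unit_square \<equiv> {0..1} \<times> {0..1}"

lemma unit_square_borel: "unit_square \<in> sets borel"
  by (intro borel_Times) auto

lemma exists_copula_measure:
  assumes "copula C"
  obtains M where "sets M = sets (restrict_space borel unit_square)"
    "\<And>u v. u \<in> {0..1} \<Longrightarrow> v \<in> {0..1} \<Longrightarrow> emeasure M ({0..u} \<times> {0..v}) = ennreal (C u v)"
proof -
  interpret rectangle_content "\<lambda>x y. C (clip x) (clip y)"
    by (rule copula_rectangle_content) fact
  obtain M where sets_M: "sets M = sets borel" and M: "\<And>a b c d. a \<le> b \<Longrightarrow> c \<le> d \<Longrightarrow>
      emeasure M ({a<..b} \<times> {c<..d}) =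
      ennreal (C (clip b) (clip d) - C (clip b) (clip c) - C (clip a) (clip d) + C (clip a) (clip c))"
    using exists_measure by auto
  \<comment> \<open>Starting half-open boxes at \<open>-1\<close> makes them contain the edges
    \<open>u = 0\<close> and \<open>v = 0\<close> of the square.\<close>
  have clip_neg: "clip (- 1) = 0"
    by (simp add: clip_def)
  have M0: "emeasure M ({-1<..u} \<times> {-1<..v}) = ennreal (C u v)" if "u \<in> {0..1}" "v \<in> {0..1}" for u v
    using that M[of "-1" u "-1" v] copula_bottom[OF assms] copula_left[OF assms]
    by (simp add: clip_neg clip_id)
  have Times_borel: "A \<times> B \<in> sets M" if "A \<in> sets borel" "B \<in> sets borel" for A B :: "real set"
    using borel_Times[OF that] by (simp add: sets_M)
  have "emeasure M ({0..u} \<times> {0..v}) = ennreal (C u v)" if "u \<in> {0..1}" "v \<in> {0..1}" for u v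
  proof (rule antisym)
    have "emeasure M ({0..u} \<times> {0..v}) \<le> emeasure M ({-1<..u} \<times> {-1<..v})"
      by (intro emeasure_mono Times_borel) auto
    then show "emeasure M ({0..u} \<times> {0..v}) \<le> ennreal (C u v)"
      using M0 that by simp
    \<comment> \<open>The strips along the two axes that the closed rectangle misses are null, since
      \<open>C 0 1 = 0\<close> and \<open>C 1 0 = 0\<close>.\<close>
    have "ennreal (C u v) = emeasure M ({-1<..u} \<times> {-1<..v})"
      using M0 that by simp
    also have "\<dots> \<le> emeasure M ({0..u} \<times> {0..v} \<union> ({-1<..0} \<times> {-1<..1} \<union> {-1<..1} \<times> {-1<..0}))"
      using that by (intro emeasure_mono sets.Un Times_borel) auto
    also have "\<dots> \<le> emeasure M ({0..u} \<times> {0..v}) +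
        (emeasure M ({-1<..0} \<times> {-1<..1}) + emeasure M ({-1<..1} \<times> {-1<..0}))"
      by (intro order_trans[OF emeasure_subadditive] add_left_mono emeasure_subadditive sets.Un Times_borel) auto
    also have "\<dots> = emeasure M ({0..u} \<times> {0..v})"
      using M0[of 0 1] M0[of 1 0] copula_left[OF assms, of 1] copula_bottom[OF assms, of 1] by simp
    finally show "ennreal (C u v) \<le> emeasure M ({0..u} \<times> {0..v})" .
  qed
  then have "emeasure (restrict_space M unit_square) ({0..u} \<times> {0..v}) = ennreal (C u v)"
    if "u \<in> {0..1}" "v \<in> {0..1}" for u v
    using that unit_square_borel sets_M by (subst emeasure_restrict_space) (auto simp: sets_eq_imp_space_eq)
  moreover have "sets (restrict_space M unit_square) = sets (restrict_space borel unit_square)"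
    by (rule sets_restrict_space_cong) fact
  ultimately show thesis
    by (rule that[rotated])
qed

text \<open>Both measures are pushed forward to the plane, where the quadrants
  \<open>{..(x, y)}\<close> are an intersection-stable generator; each meets the square in the empty
  set or in a rectangle \<open>{0..u} \<times> {0..v}\<close>.\<close>

lemma copula_measure_unique:
  assumes "sets M = sets (restrict_space borel unit_square)" "sets N = sets (restrict_space borel unit_square)"
    and eq: "\<And>u v. u \<in> {0..1} \<Longrightarrow> v \<in> {0..1} \<Longrightarrow> emeasure M ({0..u} \<times> {0..v}) = ennreal (C u v)"
      "\<And>u v. u \<in> {0..1} \<Longrightarrow> v \<in> {0..1} \<Longrightarrow> emeasure N ({0..u} \<times> {0..v}) = ennreal (C u v)"
  shows "M = N"
proof -
  let ?D = "\<lambda>M. distr M borel (\<lambda>x. x)"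
  have space: "space K = unit_square" if "sets K = sets (restrict_space borel unit_square)"
    for K :: "(real \<times> real) measure"
    using sets_eq_imp_space_eq[OF that] by (simp add: space_restrict_space)
  have emeasure_D: "emeasure (?D K) A = emeasure K (A \<inter> unit_square)"
    if "sets K = sets (restrict_space borel unit_square)" "A \<in> sets borel"
    for K :: "(real \<times> real) measure" and A
  proof -
    have "(\<lambda>x. x) \<in> restrict_space borel unit_square \<rightarrow>\<^sub>M borel"
      by (rule measurable_restrict_space1) simp
    then have "(\<lambda>x. x) \<in> K \<rightarrow>\<^sub>M borel"
      using measurable_cong_sets[OF that(1) refl] by blast
    then show ?thesis
      using that by (simp add: emeasure_distr space)
  qed
  have D_atMost: "emeasure (?D K) {..(x, y)} =
      (if x < 0 \<or> y < 0 then 0 else ennreal (C (min 1 x) (min 1 y)))"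
    if "sets K = sets (restrict_space borel unit_square)"
      "\<And>u v. u \<in> {0..1} \<Longrightarrow> v \<in> {0..1} \<Longrightarrow> emeasure K ({0..u} \<times> {0..v}) = ennreal (C u v)" for K x y
  proof -
    have "{..(x, y)} \<inter> unit_square = (if x < 0 \<or> y < 0 then {} else {0..min 1 x} \<times> {0..min 1 y})"
      by auto
    then show ?thesis
      using that by (simp add: emeasure_D)
  qed
  have "?D M = ?D N"
  proof (rule measure_eqI_generator_eq[where E = "range atMost" and \<Omega> = UNIV and A = "\<lambda>n. {..(real n, real n)}"])
    have Int: "{..(a, b)} \<inter> {..(c, d)} = {..(min a c, min b d)}" for a b c d :: real
      by auto
    show "Int_stable (range atMost :: (real \<times> real) set set)"
      unfolding Int_stable_def using Int by (metis (no_types, lifting) imageE rangeI surj_pair)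
    show "emeasure (?D M) X = emeasure (?D N) X" if "X \<in> range atMost" for X
      using that assms D_atMost by auto
    show "sets (?D M) = sigma_sets UNIV (range atMost)" "sets (?D N) = sigma_sets UNIV (range atMost)"
      using arg_cong[OF borel_eq_atMost[where 'a = "real \<times> real"], of sets] by simp_all
    show "(\<Union>n. {..(real n, real n)}) = UNIV"
    proof (intro equalityI subsetI)
      fix p :: "real \<times> real"
      obtain n :: nat where "max (fst p) (snd p) < n"
        using reals_Archimedean2 by blast
      then show "p \<in> (\<Union>n. {..(real n, real n)})"
        by (intro UN_I[of n]) (auto simp: less_eq_prod_def)
    qed simp
    show "emeasure (?D M) {..(real n, real n)} \<noteq> \<infinity>" for n
      using assms by (subst D_atMost) auto
  qed auto
  show "M = N"
  proof (rule measure_eqI)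
    show "emeasure M A = emeasure N A" if "A \<in> sets M" for A
    proof -
      have "A \<in> sets borel" "A \<subseteq> unit_square"
        using that assms(1) unit_square_borel by (auto simp: sets_restrict_space_iff)
      then show ?thesis
        using emeasure_D[OF assms(1), of A] emeasure_D[OF assms(2), of A] \<open>?D M = ?D N\<close>
        by (simp add: Int_absorb2)
    qed
  qed (use assms in simp)
qed

text \<open>Existence and uniqueness make the definite description in \<open>copula_measure\<close>
  meaningful, so its defining property becomes available.\<close>

lemma
  assumes "copula C"
  shows sets_copula_measure: "sets (copula_measure C) = sets (restrict_space borel unit_square)"
    and emeasure_copula_measure:
      "\<And>u v. u \<in> {0..1} \<Longrightarrow> v \<in> {0..1} \<Longrightarrow> emeasure (copula_measure C) ({0..u} \<times> {0..v}) = ennreal (C u v)"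
proof -
  let ?P = "\<lambda>M. sets M = sets (restrict_space borel unit_square) \<and>
      (\<forall>u\<in>{0..1}. \<forall>v\<in>{0..1}. emeasure M ({0..u} \<times> {0..v}) = ennreal (C u v))"
  obtain M where M: "?P M"
    using exists_copula_measure[OF assms] by metis
  have "?P (copula_measure C)"
    unfolding copula_measure_def
  proof (rule theI)
    show "?P M" by (rule M)
    show "N = M" if "?P N" for N
      using that M by (intro copula_measure_unique[of N M C]) auto
  qed
  then show "sets (copula_measure C) = sets (restrict_space borel unit_square)"
    "\<And>u v. u \<in> {0..1} \<Longrightarrow> v \<in> {0..1} \<Longrightarrow> emeasure (copula_measure C) ({0..u} \<times> {0..v}) = ennreal (C u v)"
    by auto
qed

section \<open>Spearman's rho as a double integral\<close>

lemma space_copula_measure: "copula C \<Longrightarrow> space (copula_measure C) = unit_square"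
  using sets_eq_imp_space_eq[OF sets_copula_measure] by (simp add: space_restrict_space)

lemma finite_measure_copula_measure:
  assumes "copula C"
  shows "finite_measure (copula_measure C)"
  using emeasure_copula_measure[OF assms, of 1 1]
  by (intro finite_measureI) (simp add: space_copula_measure[OF assms])

lemma borel_measurable_copula_measure:
  assumes "copula C" "f \<in> borel \<rightarrow>\<^sub>M borel"
  shows "f \<in> copula_measure C \<rightarrow>\<^sub>M borel"
  using measurable_restrict_space1[OF assms(2)] measurable_cong_sets[OF sets_copula_measure[OF assms(1)] refl]
  by blast

text \<open>Inclusion-exclusion for the complement in the square of mass 1. This survival function
  is what Fubini produces below.\<close>

lemma emeasure_copula_measure_upper:
  assumes "copula C" "s \<in> {0..1}" "t \<in> {0..1}"
  shows "emeasure (copula_measure C) ({s<..1} \<times> {t<..1}) = ennreal (1 - s - t + C s t)"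
proof -
  let ?M = "copula_measure C" and ?A = "{0..s} \<times> {0..1::real}" and ?B = "{0..1::real} \<times> {0..t}"
  interpret finite_measure ?M
    by (rule finite_measure_copula_measure) fact
  have rect: "{0..u} \<times> {0..v} \<in> sets ?M" if "u \<in> {0..1}" "v \<in> {0..1}" for u v
    using that unit_square_borel
    by (auto simp: sets_copula_measure[OF assms(1)] sets_restrict_space_iff intro!: borel_Times)
  have m: "measure ?M ({0..u} \<times> {0..v}) = C u v" if "u \<in> {0..1}" "v \<in> {0..1}" for u v
    using that emeasure_copula_measure[OF assms(1) that] copula_bounds(1)[OF assms(1), of u v]
    by (simp add: measure_def)
  have AB: "?A \<inter> ?B = {0..s} \<times> {0..t}"
    using assms by auto
  have mU: "measure ?M (?A \<union> ?B) = s + t - C s t"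
    using assms rect m[of s 1] m[of 1 t] m[of s t] copula_top[OF assms(1)] copula_right[OF assms(1)]
    by (subst measure_Un3) (simp_all add: AB fmeasurable_eq_sets)
  have "?A \<union> ?B \<in> sets ?M"
    using rect[of s 1] rect[of 1 t] assms by (intro sets.Un) simp_all
  moreover have "?A \<union> ?B \<subseteq> unit_square"
    using assms by auto
  ultimately have "measure ?M (unit_square - (?A \<union> ?B)) = measure ?M unit_square - measure ?M (?A \<union> ?B)"
    using rect[of 1 1] by (intro finite_measure_Diff) simp_all
  moreover have "{s<..1} \<times> {t<..1} = unit_square - (?A \<union> ?B)"
    using assms by auto
  ultimately have "measure ?M ({s<..1} \<times> {t<..1}) = 1 - s - t + C s t"
    using m[of 1 1] mU copula_top[OF assms(1), of 1] by simp
  then show ?thesis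
    by (simp add: emeasure_eq_measure)
qed

lemma has_integral_affine:
  fixes a b p q :: real
  assumes "a \<le> b"
  shows "((\<lambda>x. p + q * x) has_integral (p * (b - a) + q * (b\<^sup>2 - a\<^sup>2) / 2)) {a..b}"
  using has_integral_add[OF has_integral_const_real[of p a b]
      has_integral_mult_right[OF ident_has_integral[OF assms], of q]] assms
  by (simp add: mult.commute)

text \<open>The affine part \<open>1 - s - t\<close> has integral 0 over the square.\<close>

lemma double_integral_survival:
  assumes "copula C"
  shows "integral unit_square (\<lambda>(s, t). 1 - s - t + C s t) = double_integral C"
proof -
  have cont: "continuous_on (cbox (0, 0) (1, 1)) (\<lambda>(s, t). 1 - s - t + C s t)"
    using continuous_on_copula[OF assms] unfolding split_beta
    by (intro continuous_intros) (simp_all add: cbox_Pair_eq)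
  have "integral unit_square (\<lambda>(s, t). 1 - s - t + C s t) =
      integral (cbox (0, 0) (1, 1)) (\<lambda>(s, t). 1 - s - t + C s t)"
    by (simp add: cbox_Pair_eq)
  also have "\<dots> = integral {0..1} (\<lambda>s. integral {0..1} (\<lambda>t. 1 - s - t + C s t))"
    using integral_prod_continuous[OF cont] by simp
  also have "\<dots> = integral {0..1} (\<lambda>t. integral {0..1} (\<lambda>s. 1 - s - t + C s t))"
    using integral_swap_continuous[OF cont] by simp
  also have "\<dots> = integral {0..1} (\<lambda>t. (1/2 - t) + integral {0..1} (\<lambda>s. C s t))"
  proof (intro integral_cong integral_unique)
    fix t :: real assume "t \<in> {0..1}"
    then have "(\<lambda>s. C s t) integrable_on {0..1}"
      using assms by (intro integrable_continuous_real continuous_on_copula_slice)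
    then show "((\<lambda>s. 1 - s - t + C s t) has_integral (1/2 - t) + integral {0..1} (\<lambda>s. C s t)) {0..1}"
      using has_integral_add[OF has_integral_affine[of 0 1 "1 - t" "-1"] integrable_integral[of "\<lambda>s. C s t"]]
      by (simp add: algebra_simps)
  qed
  also have "\<dots> = double_integral C"
  proof (rule integral_unique)
    have "(\<lambda>t. integral {0..1} (\<lambda>s. C s t)) integrable_on {0..1}"
      using assms by (intro integrable_continuous_real continuous_on_slice_integral)
    from has_integral_add[OF has_integral_affine[of 0 1 "1/2" "-1"] integrable_integral[OF this]]
    show "((\<lambda>t. (1/2 - t) + integral {0..1} (\<lambda>s. C s t)) has_integral double_integral C) {0..1}"
      by (simp add: double_integral_def)
  qed
  finally show ?thesis .
qed

lemma nn_integral_copula_measure_mult: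
  assumes "copula C"
  shows "(\<integral>\<^sup>+ p. ennreal (fst p * snd p) \<partial>copula_measure C) = ennreal (double_integral C)"
proof -
  let ?M = "copula_measure C" and ?L = "lborel :: (real \<times> real) measure"
  \<comment> \<open>Indicator that \<open>q\<close> lies in
    \<open>[0, fst p) \<times> [0, snd p)\<close>. Integrating out \<open>q\<close> gives the
    product of the coordinates of \<open>p\<close>; integrating out \<open>p\<close> gives the
    survival function at \<open>q\<close>.\<close>
  define f :: "real \<times> real \<Rightarrow> real \<times> real \<Rightarrow> ennreal" where
    "f p q = indicator {r. 0 \<le> fst (snd r) \<and> fst (snd r) < fst (fst r) \<and>
        0 \<le> snd (snd r) \<and> snd (snd r) < snd (fst r)} (p, q)" for p q
  interpret M: finite_measure ?M
    by (rule finite_measure_copula_measure) fact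
  interpret pair_sigma_finite ?M ?L
    by standard
  have [measurable]: "fst \<in> borel_measurable ?M" "snd \<in> borel_measurable ?M"
    "fst \<in> borel_measurable ?L" "snd \<in> borel_measurable ?L"
    by (auto intro!: borel_measurable_copula_measure[OF assms] borel_measurable_continuous_onI
        continuous_intros)
  have meas: "case_prod f \<in> borel_measurable (?M \<Otimes>\<^sub>M ?L)"
    unfolding f_def case_prod_unfold prod.collapse by measurable
  have inner: "(\<integral>\<^sup>+ q. f p q \<partial>?L) = ennreal (fst p * snd p)" if "p \<in> space ?M" for p
  proof -
    have p: "0 \<le> fst p" "0 \<le> snd p"
      using that by (auto simp: space_copula_measure[OF assms])
    have "(\<integral>\<^sup>+ q. f p q \<partial>?L) = (\<integral>\<^sup>+ q. indicator ({0..<fst p} \<times> {0..<snd p}) q \<partial>(lborel \<Otimes>\<^sub>M lborel))"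
      by (simp add: lborel_prod) (auto simp: f_def intro!: nn_integral_cong split: split_indicator)
    also have "\<dots> = ennreal (fst p * snd p)"
      using p by (subst nn_integral_indicator)
        (auto simp: lborel.emeasure_pair_measure_Times ennreal_mult)
    finally show ?thesis .
  qed
  have outer: "(\<integral>\<^sup>+ p. f p q \<partial>?M) =
      ennreal ((\<lambda>(s, t). 1 - s - t + C s t) q) * indicator unit_square q" for q
  proof -
    obtain s t where q: "q = (s, t)"
      by (cases q)
    show ?thesis
    proof (cases "q \<in> unit_square")
      case True
      have "(\<integral>\<^sup>+ p. f p q \<partial>?M) = (\<integral>\<^sup>+ p. indicator ({s<..1} \<times> {t<..1}) p \<partial>?M)"
        using True space_copula_measure[OF assms] q
        by (intro nn_integral_cong) (auto simp: f_def split: split_indicator)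
      also have "\<dots> = emeasure ?M ({s<..1} \<times> {t<..1})"
        using True unit_square_borel q
        by (intro nn_integral_indicator)
          (auto simp: sets_copula_measure[OF assms] sets_restrict_space_iff intro!: borel_Times)
      finally show ?thesis
        using True emeasure_copula_measure_upper[OF assms, of s t] q by simp
    next
      case False
      then have "f p q = 0" if "p \<in> space ?M" for p
        using that space_copula_measure[OF assms] q by (auto simp: f_def split: split_indicator)
      then show ?thesis
        using False by (simp cong: nn_integral_cong)
    qed
  qed
  have cont: "continuous_on unit_square (\<lambda>(s, t). 1 - s - t + C s t)"
    using continuous_on_copula[OF assms] unfolding split_beta
    by (intro continuous_intros) simp_all
  have "(\<integral>\<^sup>+ p. ennreal (fst p * snd p) \<partial>?M) = (\<integral>\<^sup>+ p. \<integral>\<^sup>+ q. f p q \<partial>?L \<partial>?M)"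
    by (intro nn_integral_cong) (simp add: inner)
  also have "\<dots> = (\<integral>\<^sup>+ q. \<integral>\<^sup>+ p. f p q \<partial>?M \<partial>?L)"
    by (rule Fubini'[OF meas, symmetric])
  also have "\<dots> = (\<integral>\<^sup>+ q. ennreal ((\<lambda>(s, t). 1 - s - t + C s t) q) * indicator unit_square q \<partial>?L)"
    by (simp only: outer)
  also have "\<dots> = ennreal (double_integral C)"
  proof (rule nn_integral_has_integral_lebesgue')
    show "0 \<le> (\<lambda>(s, t). 1 - s - t + C s t) q" if "q \<in> unit_square" for q
      using that copula_bounds(4)[OF assms, of "fst q" "snd q"] by (auto simp: split_beta)
    have "(\<lambda>(s, t). 1 - s - t + C s t) integrable_on cbox (0, 0) (1, 1)"
      using cont by (intro integrable_continuous) (simp add: cbox_Pair_eq)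
    then show "((\<lambda>(s, t). 1 - s - t + C s t) has_integral double_integral C) unit_square"
      unfolding double_integral_survival[OF assms, symmetric]
      by (simp add: cbox_Pair_eq integrable_integral)
  qed
  finally show ?thesis .
qed

lemma double_integral_nonneg:
  assumes "copula C"
  shows "0 \<le> double_integral C"
  unfolding double_integral_def
  by (intro integral_nonneg integrable_continuous_real continuous_on_slice_integral
      continuous_on_copula_slice assms) (auto intro: copula_bounds(1)[OF assms])

lemma spearman_rho_eq:
  assumes "copula C"
  shows "spearman_rho C = 12 * double_integral C - 3"
proof -
  let ?M = "copula_measure C"
  have "(\<lambda>p. fst p * snd p) \<in> borel_measurable ?M"
    by (intro borel_measurable_copula_measure[OF assms] borel_measurable_continuous_onI continuous_intros)
  moreover have "AE p in ?M. 0 \<le> fst p * snd p"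
    by (intro AE_I2) (auto simp: space_copula_measure[OF assms])
  ultimately have "(\<integral> p. fst p * snd p \<partial>?M) = double_integral C"
    using double_integral_nonneg[OF assms]
    by (simp add: integral_eq_nn_integral nn_integral_copula_measure_mult[OF assms])
  then show ?thesis
    by (simp add: spearman_rho_def concordance_def Pi_copula_def case_prod_unfold)
qed

section \<open>Bounds from a single value\<close>

text \<open>The piecewise linear functions below are combinations of such hinges, so this one
  integral evaluates them without splitting the interval again.\<close>

lemma has_integral_max_0:
  fixes p :: real
  assumes "p \<in> {0..1}"
  shows "((\<lambda>u. max 0 (u - p)) has_integral (1 - p)\<^sup>2 / 2) {0..1}"
proof -
  have "((\<lambda>u. max 0 (u - p)) has_integral 0) {0..p}"
    by (rule has_integral_is_0) simp
  moreover have "((\<lambda>u. max 0 (u - p)) has_integral (1 - p)\<^sup>2 / 2) {p..1}"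
  proof (rule has_integral_eq)
    show "((\<lambda>u. - p + 1 * u) has_integral (1 - p)\<^sup>2 / 2) {p..1}"
      using has_integral_affine[of p 1 "- p" 1] assms by (simp add: power2_eq_square algebra_simps diff_divide_distrib add_divide_distrib)
  qed auto
  ultimately show ?thesis
    using has_integral_combine[of 0 p 1 "\<lambda>u. max 0 (u - p)" 0 "(1 - p)\<^sup>2 / 2"] assms by simp
qed

text \<open>
  The smallest function \<open>u \<mapsto> C(u,v)\<close> compatible with \<open>C(a,v) = h(v)\<close>: it grows with slope 1 on
  \<open>[a - h v, a]\<close> and on \<open>[1 - v + h v, 1]\<close> and is constant elsewhere.
\<close>

definition glued :: "real \<Rightarrow> (real \<Rightarrow> real) \<Rightarrow> real \<Rightarrow> real \<Rightarrow> real" where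
  "glued a h u v = max 0 (u - (a - h v)) - max 0 (u - a) + max 0 (u - (1 - v + h v))"

lemma has_integral_glued:
  assumes "0 \<le> h v" "h v \<le> a" "h v \<le> v" "a + v - 1 \<le> h v" "a \<le> 1" "v \<le> 1"
  shows "((\<lambda>u. glued a h u v) has_integral v\<^sup>2 / 2 + h v * (1 - a - v + h v)) {0..1}"
proof -
  have "((\<lambda>u. glued a h u v) has_integral
      (1 - (a - h v))\<^sup>2 / 2 - (1 - a)\<^sup>2 / 2 + (1 - (1 - v + h v))\<^sup>2 / 2) {0..1}"
    unfolding glued_def
    by (intro has_integral_add has_integral_diff has_integral_max_0) (use assms in auto)
  then show ?thesis
    by (rule has_integral_eq_rhs) (simp add: power2_eq_square field_simps)
qed

text \<open>Left of \<open>a\<close> the left side is \<open>max 0 (C a v - (a - u))\<close>, a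
  bound by the Lipschitz property; right of \<open>a\<close> it is
  \<open>max (C a v) (u + v - 1)\<close>, a bound by monotonicity and
  \<open>copula_bounds\<close>.\<close>

lemma glued_le_copula:
  assumes "copula C" "a \<in> {0..1}" "u \<in> {0..1}" "v \<in> {0..1}"
  shows "glued a (C a) u v \<le> C u v"
  using assms copula_bounds[OF assms(1), of u v] copula_bounds[OF assms(1), of a v]
    copula_diff1[OF assms(1), of u a v] copula_mono1[OF assms(1), of a u v]
  by (cases "u \<le> a") (auto simp: glued_def max_def)

text \<open>
  A tent over \<open>[b - d, b + e]\<close> of height \<open>d * e\<close> at \<open>b\<close>: the guaranteed excess of the integral of
  the slice \<open>C(\<cdot>,v)\<close> over \<open>v\<^sup>2 / 2\<close>.
\<close>

definition tent :: "real \<Rightarrow> real \<Rightarrow> real \<Rightarrow> real \<Rightarrow> real" where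
  "tent b d e v = e * max 0 (v - (b - d)) - (d + e) * max 0 (v - b) + d * max 0 (v - (b + e))"

lemma has_integral_tent:
  assumes "0 \<le> d" "0 \<le> e" "d \<le> b" "b + e \<le> 1"
  shows "(tent b d e has_integral d * e * (d + e) / 2) {0..1}"
proof -
  have "(tent b d e has_integral
      e * ((1 - (b - d))\<^sup>2 / 2) - (d + e) * ((1 - b)\<^sup>2 / 2) + d * ((1 - (b + e))\<^sup>2 / 2)) {0..1}"
    unfolding tent_def[abs_def]
    by (intro has_integral_add has_integral_diff has_integral_mult_right has_integral_max_0)
      (use assms in auto)
  then show ?thesis
    by (rule has_integral_eq_rhs) (simp add: power2_eq_square field_simps)
qed

lemma tent_cases:
  assumes "0 \<le> d" "0 \<le> e"
  shows "tent b d e v =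
    (if v \<le> b - d \<or> b + e \<le> v then 0 else if v \<le> b then (d - (b - v)) * e else d * (e - (v - b)))"
proof -
  consider "v \<le> b - d" | "b - d < v" "v \<le> b" "v < b + e" | "b < v" "v < b + e" | "b < v" "b + e \<le> v"
    | "v = b" "e = 0"
    using assms by linarith
  then show ?thesis
    using assms by cases (simp_all add: tent_def algebra_simps)
qed

lemma has_integral_tent_plus:
  assumes "0 \<le> d" "0 \<le> e" "d \<le> b" "b + e \<le> 1"
  shows "((\<lambda>v. v\<^sup>2 / 2 + tent b d e v) has_integral 1 / 6 + d * e * (d + e) / 2) {0..1}"
proof (rule has_integral_add[OF _ has_integral_tent[OF assms]])
  have "((\<lambda>v::real. v\<^sup>2 / 2) has_integral 1 ^ 3 / 6 - 0 ^ 3 / 6) {0..1}"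
    by (rule fundamental_theorem_of_calculus)
      (auto intro!: derivative_eq_intros simp: has_real_derivative_iff_has_vector_derivative[symmetric])
  then show "((\<lambda>v::real. v\<^sup>2 / 2) has_integral 1 / 6) {0..1}"
    by simp
qed

text \<open>Here \<open>d\<close> and \<open>e\<close> are the masses of the lower left and upper
  right quadrants at \<open>(a, b)\<close>.\<close>

lemma double_integral_ge:
  assumes "copula C" "a \<in> {0..1}" "b \<in> {0..1}"
  defines "d \<equiv> C a b" and "e \<equiv> C a b + 1 - a - b"
  shows "1 / 6 + d * e * (d + e) / 2 \<le> double_integral C"
proof -
  have de: "0 \<le> d" "0 \<le> e" "d \<le> b" "b + e \<le> 1"
    using copula_bounds[OF assms(1), of a b] assms by (auto simp: d_def e_def)
  have slice: "v\<^sup>2 / 2 + tent b d e v \<le> integral {0..1} (\<lambda>u. C u v)" if v: "v \<in> {0..1}" for v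
  proof -
    have h: "0 \<le> C a v" "C a v \<le> a" "C a v \<le> v" "a + v - 1 \<le> C a v"
      using copula_bounds[OF assms(1), of a v] assms(2) v by auto
    \<comment> \<open>For \<open>v \<le> b\<close> the first factor is at least
      \<open>d - (b - v)\<close> by the Lipschitz property, which also keeps the second at least
      \<open>e\<close>. For \<open>v > b\<close> the first stays at least \<open>d\<close>, so the
      second is at least \<open>e - (v - b)\<close>.\<close>
    have "tent b d e v \<le> C a v * (1 - a - v + C a v)"
    proof (cases "v \<le> b - d \<or> b + e \<le> v")
      case True
      then show ?thesis
        using h de by (simp add: tent_cases)
    next
      case False
      show ?thesis
      proof (cases "v \<le> b")
        case True
        have "d - C a v \<le> b - v"
          using copula_diff2[OF assms(1), of a v b] True v assms by (simp add: d_def)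
        then have "(d - (b - v)) * e \<le> C a v * (1 - a - v + C a v)"
          using h de False by (intro mult_mono) (auto simp: e_def d_def)
        then show ?thesis
          using True False de by (simp add: tent_cases)
      next
        case False': False
        have "d \<le> C a v"
          using copula_mono2[OF assms(1), of a b v] False' v assms by (simp add: d_def)
        then have "d * (e - (v - b)) \<le> C a v * (1 - a - v + C a v)"
          using h de False by (intro mult_mono) (auto simp: e_def d_def)
        then show ?thesis
          using False False' de by (simp add: tent_cases)
      qed
    qed
    moreover have "v\<^sup>2 / 2 + C a v * (1 - a - v + C a v) \<le> integral {0..1} (\<lambda>u. C u v)"
    proof (rule has_integral_le[OF has_integral_glued])
      show "((\<lambda>u. C u v) has_integral integral {0..1} (\<lambda>u. C u v)) {0..1}"
        using v by (intro integrable_integral integrable_continuous_real continuous_on_copula_slice assms)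
    qed (use h v assms glued_le_copula in auto)
    ultimately show ?thesis
      by linarith
  qed
  show ?thesis
    unfolding double_integral_def
  proof (rule has_integral_le[OF has_integral_tent_plus[OF de]])
    show "((\<lambda>v. integral {0..1} (\<lambda>u. C u v)) has_integral
        integral {0..1} (\<lambda>v. integral {0..1} (\<lambda>u. C u v))) {0..1}"
      by (intro integrable_integral integrable_continuous_real continuous_on_slice_integral assms)
  qed (rule slice)
qed

text \<open>If \<open>C\<close> is the joint distribution function of \<open>(U, V)\<close>, this is
  that of \<open>(1 - U, V)\<close>.\<close>

definition flip :: "(real \<Rightarrow> real \<Rightarrow> real) \<Rightarrow> real \<Rightarrow> real \<Rightarrow> real" where
  "flip C u v = v - C (1 - u) v"

lemma copula_flip:
  assumes "copula C"
  shows "copula (flip C)"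
  unfolding copula_def
proof (intro conjI ballI impI)
  fix u1 u2 v1 v2 :: real
  assume "u1 \<in> {0..1}" "u2 \<in> {0..1}" "v1 \<in> {0..1}" "v2 \<in> {0..1}" "u1 \<le> u2" "v1 \<le> v2"
  then show "0 \<le> flip C u2 v2 - flip C u2 v1 - flip C u1 v2 + flip C u1 v1"
    using copula_rect[OF assms, of "1 - u2" "1 - u1" v1 v2] by (simp add: flip_def)
qed (use copula_bottom[OF assms] copula_left[OF assms] copula_top[OF assms] copula_right[OF assms] in
    \<open>auto simp: flip_def\<close>)

lemma double_integral_flip:
  assumes "copula C"
  shows "double_integral (flip C) = 1 / 2 - double_integral C"
proof -
  have slice: "integral {0..1} (\<lambda>u. flip C u v) = v - integral {0..1} (\<lambda>u. C u v)" if "v \<in> {0..1}" for v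
  proof (rule integral_unique)
    have "((\<lambda>u. C u v) has_integral integral {0..1} (\<lambda>u. C u v)) (cbox 0 1)"
      using that by (simp add: integrable_integral integrable_continuous_real continuous_on_copula_slice assms)
    from has_integral_affinity[OF this, of "- 1" 1]
    have "((\<lambda>u. C (1 - u) v) has_integral integral {0..1} (\<lambda>u. C u v)) {0..1}"
      by simp
    from has_integral_diff[OF has_integral_const_real[of v 0 1] this]
    show "((\<lambda>u. flip C u v) has_integral v - integral {0..1} (\<lambda>u. C u v)) {0..1}"
      by (simp add: flip_def)
  qed
  have "double_integral (flip C) = integral {0..1} (\<lambda>v. v - integral {0..1} (\<lambda>u. C u v))"
    unfolding double_integral_def by (intro integral_cong slice)
  also have "\<dots> = 1 / 2 - double_integral C"
  proof (rule integral_unique)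
    have "(\<lambda>v. integral {0..1} (\<lambda>u. C u v)) integrable_on {0..1}"
      by (intro integrable_continuous_real continuous_on_slice_integral assms)
    from has_integral_diff[OF has_integral_affine[of 0 1 0 1] integrable_integral[OF this]]
    show "((\<lambda>v. v - integral {0..1} (\<lambda>u. C u v)) has_integral 1 / 2 - double_integral C) {0..1}"
      by (simp add: double_integral_def)
  qed
  finally show ?thesis .
qed

text \<open>The lower bound for \<open>flip C\<close> at \<open>(1 - p, q)\<close>, where the two
  quadrant masses become \<open>q - C p q\<close> and \<open>p - C p q\<close>.\<close>

lemma double_integral_le:
  assumes "copula C" "p \<in> {0..1}" "q \<in> {0..1}"
  shows "double_integral C \<le> 1 / 3 - (q - C p q) * (p - C p q) * (p + q - 2 * C p q) / 2"
proof -
  have "flip C (1 - p) q = q - C p q" "q - C p q + 1 - (1 - p) - q = p - C p q"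
    by (simp_all add: flip_def)
  moreover have "q - C p q + (p - C p q) = p + q - 2 * C p q"
    by simp
  ultimately show ?thesis
    using double_integral_ge[OF copula_flip[OF assms(1)], of "1 - p" q] assms(2,3)
    by (simp add: double_integral_flip[OF assms(1)] add.commute[of p q])
qed

section \<open>The asymmetry measure and the bounds on rho\<close>

lemma mu_inf_eqI:
  assumes "\<And>u v. u \<in> {0..1} \<Longrightarrow> v \<in> {0..1} \<Longrightarrow> \<bar>C u v - C v u\<bar> \<le> m"
    "a \<in> {0..1}" "b \<in> {0..1}" "\<bar>C a b - C b a\<bar> = m"
  shows "mu_inf C = m"
  unfolding mu_inf_def
proof (rule cSup_eq_maximum)
  show "m \<in> (\<lambda>(u, v). \<bar>C u v - C v u\<bar>) ` unit_square"
    using assms(2-4) by (intro image_eqI[of _ _ "(a, b)"]) auto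
qed (use assms(1) in auto)

lemma
  assumes "copula C"
  shows mu_inf_attained: "\<exists>a\<in>{0..1}. \<exists>b\<in>{0..1}. C a b - C b a = mu_inf C"
    and mu_inf_upper: "\<And>u v. u \<in> {0..1} \<Longrightarrow> v \<in> {0..1} \<Longrightarrow> \<bar>C u v - C v u\<bar> \<le> mu_inf C"
proof -
  have "continuous_on unit_square (\<lambda>p. \<bar>C (fst p) (snd p) - C (snd p) (fst p)\<bar>)"
    using continuous_on_copula[OF assms] continuous_on_copula[OF copula_transpose[OF assms]]
    unfolding case_prod_unfold by (intro continuous_intros)
  moreover have "compact unit_square" "unit_square \<noteq> {}"
    by (auto intro!: compact_Times)
  ultimately obtain p where p: "p \<in> unit_square"
    "\<And>q. q \<in> unit_square \<Longrightarrow>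
      \<bar>C (fst q) (snd q) - C (snd q) (fst q)\<bar> \<le> \<bar>C (fst p) (snd p) - C (snd p) (fst p)\<bar>"
    using continuous_attains_sup[of unit_square] by blast
  obtain a b where ab: "p = (a, b)" "a \<in> {0..1}" "b \<in> {0..1}"
    using p(1) by auto
  have max: "\<bar>C u v - C v u\<bar> \<le> \<bar>C a b - C b a\<bar>" if "u \<in> {0..1}" "v \<in> {0..1}" for u v
    using p(2)[of "(u, v)"] that ab by simp
  have mu: "mu_inf C = \<bar>C a b - C b a\<bar>"
    by (rule mu_inf_eqI[OF max ab(2,3) refl])
  \<comment> \<open>Swapping \<open>a\<close> and \<open>b\<close> if necessary makes the difference
    nonnegative.\<close>
  show "\<exists>a\<in>{0..1}. \<exists>b\<in>{0..1}. C a b - C b a = mu_inf C"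
    using ab mu by (cases "C b a \<le> C a b") force+
  show "\<bar>C u v - C v u\<bar> \<le> mu_inf C" if "u \<in> {0..1}" "v \<in> {0..1}" for u v
    using max that mu by simp
qed

lemma mult_mult_add_ge:
  fixes x y s t :: real
  assumes "0 \<le> s" "s \<le> x" "0 \<le> t" "t \<le> y"
  shows "s * t * (s + t) \<le> x * y * (x + y)"
  using assms by (intro mult_mono add_mono mult_nonneg_nonneg) auto

lemma spearman_rho_bounds:
  assumes "copula C"
  shows "12 * (mu_inf C) ^ 3 - 1 \<le> spearman_rho C" "spearman_rho C \<le> 1 - 36 * (mu_inf C) ^ 3"
proof -
  let ?m = "mu_inf C"
  obtain a b where ab: "a \<in> {0..1}" "b \<in> {0..1}" "C a b - C b a = ?m"
    using mu_inf_attained[OF assms] by blast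
  have m: "0 \<le> ?m"
    using mu_inf_upper[OF assms, of 0 0] by simp
  note ineqs = copula_bounds[OF assms, of a b] copula_bounds[OF assms, of b a]
  \<comment> \<open>The first factor uses \<open>C b a \<ge> 0\<close>, the second
    \<open>C b a \<ge> a + b - 1\<close>.\<close>
  have "?m * ?m * (?m + ?m) \<le> C a b * (C a b + 1 - a - b) * (C a b + (C a b + 1 - a - b))"
    using m ab ineqs by (intro mult_mult_add_ge) auto
  then show "12 * ?m ^ 3 - 1 \<le> spearman_rho C"
    using double_integral_ge[OF assms ab(1,2)] by (simp add: spearman_rho_eq[OF assms] power3_eq_cube)
  \<comment> \<open>Both differences are at least \<open>?m\<close> since \<open>C a b\<close> is at
    most \<open>a\<close> and \<open>b\<close>. Comparing \<open>C a b\<close> and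
    \<open>C b a\<close> through a diagonal point gives \<open>\<bar>a - b\<bar> \<ge> ?m\<close>,
    so the difference with the larger coordinate is at least \<open>2 * ?m\<close>.\<close>
  have "3 * ?m ^ 3 \<le> (a - C b a) * (b - C b a) * (b + a - 2 * C b a) / 2"
  proof (cases "a \<le> b")
    case True
    then have "C a b - C a a \<le> b - a" "C a a \<le> C b a"
      using copula_diff2[OF assms, of a a b] copula_mono1[OF assms, of a b a] ab by auto
    then have "?m * (2 * ?m) * (?m + 2 * ?m) \<le> (a - C b a) * (b - C b a) * ((a - C b a) + (b - C b a))"
      using m ab ineqs by (intro mult_mult_add_ge) auto
    then show ?thesis
      by (simp add: power3_eq_cube algebra_simps)
  next
    case False
    then have "C a b - C b b \<le> a - b" "C b b \<le> C b a"
      using copula_diff1[OF assms, of b a b] copula_mono2[OF assms, of b b a] ab by auto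
    then have "2 * ?m * ?m * (2 * ?m + ?m) \<le> (a - C b a) * (b - C b a) * ((a - C b a) + (b - C b a))"
      using m ab ineqs by (intro mult_mult_add_ge) auto
    then show ?thesis
      by (simp add: power3_eq_cube algebra_simps)
  qed
  then show "spearman_rho C \<le> 1 - 36 * ?m ^ 3"
    using double_integral_le[OF assms ab(2,1)] by (simp add: spearman_rho_eq[OF assms])
qed

section \<open>Extremal copulas\<close>

text \<open>\<open>v\<close> enters only through the hinge positions \<open>a - h v\<close> and
  \<open>1 - (v - h v)\<close>. Both move left as \<open>v\<close> grows, and a hinge further left
  has larger increments in \<open>u\<close>.\<close>

lemma glued_mono:
  assumes "u \<le> u'" "h v \<le> h v'" "v - h v \<le> v' - h v'"
  shows "0 \<le> glued a h u' v' - glued a h u' v - glued a h u v' + glued a h u v"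
proof -
  have "max 0 (u' - p) - max 0 (u - p) \<le> max 0 (u' - p') - max 0 (u - p')" if "p' \<le> p" for p p' :: real
    using assms(1) that by (auto simp: max_def)
  from this[of "a - h v'" "a - h v"] this[of "1 - v' + h v'" "1 - v + h v"] show ?thesis
    using assms by (simp add: glued_def)
qed

text \<open>The slicewise lower bound is thus itself a copula, which is why the estimate can be
  sharp.\<close>

lemma copula_glued:
  assumes "0 \<le> a" "a \<le> 1" "h 0 = 0" "h 1 = a"
    and mono: "\<And>v v'. 0 \<le> v \<Longrightarrow> v \<le> v' \<Longrightarrow> v' \<le> 1 \<Longrightarrow> h v \<le> h v'"
    and lip: "\<And>v v'. 0 \<le> v \<Longrightarrow> v \<le> v' \<Longrightarrow> v' \<le> 1 \<Longrightarrow> v - h v \<le> v' - h v'"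
  shows "copula (glued a h)"
  unfolding copula_def
proof (intro conjI ballI impI)
  fix u :: real assume u: "u \<in> {0..1}"
  have h: "0 \<le> h u" "h u \<le> a" "h u \<le> u" "a + u - 1 \<le> h u"
    using mono[of 0 u] mono[of u 1] lip[of 0 u] lip[of u 1] assms(3,4) u by auto
  show "glued a h u 0 = 0" "glued a h u 1 = u"
    using u assms(1-4) by (simp_all add: glued_def)
  show "glued a h 0 u = 0" "glued a h 1 u = u"
    using u assms(1-4) h by (simp_all add: glued_def)
next
  fix u1 u2 v1 v2 :: real
  assume "u1 \<in> {0..1}" "u2 \<in> {0..1}" "v1 \<in> {0..1}" "v2 \<in> {0..1}" "u1 \<le> u2" "v1 \<le> v2"
  then show "0 \<le> glued a h u2 v2 - glued a h u2 v1 - glued a h u1 v2 + glued a h u1 v1"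
    by (intro glued_mono mono lip) auto
qed

text \<open>The pointwise smallest section at \<open>a\<close> of a copula taking the value \<open>d\<close> at \<open>(a, b)\<close>.\<close>

definition least_section :: "real \<Rightarrow> real \<Rightarrow> real \<Rightarrow> real \<Rightarrow> real" where
  "least_section a b d v = max 0 (max (a + v - 1) (d - max 0 (b - v)))"

context
  fixes a b d :: real
  assumes ab: "a \<le> 1" "b \<le> 1" and d: "0 \<le> d" "d \<le> a" "d \<le> b" "a + b - 1 \<le> d"
begin

lemma copula_least: "copula (glued a (least_section a b d))"
  by (rule copula_glued) (use ab d in \<open>auto simp: least_section_def max_def\<close>)

text \<open>For the least section the slice excess \<open>h v * (1 - a - v + h v)\<close> equals the
  tent, so \<open>double_integral_ge\<close> holds with equality.\<close>

lemma double_integral_least: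
  "double_integral (glued a (least_section a b d)) =
    1 / 6 + d * (d + 1 - a - b) * (d + (d + 1 - a - b)) / 2"
proof -
  define e where "e = d + 1 - a - b"
  have e: "0 \<le> e" "b + e \<le> 1"
    using d by (simp_all add: e_def)
  have slice: "integral {0..1} (\<lambda>u. glued a (least_section a b d) u v) = v\<^sup>2 / 2 + tent b d e v"
    if v: "v \<in> {0..1}" for v
  proof -
    let ?h = "least_section a b d v"
    have "?h * (1 - a - v + ?h) = tent b d e v"
    proof -
      consider "v \<le> b - d" | "b + e \<le> v" | "b - d < v" "v \<le> b" "v < b + e" | "b < v" "v < b + e"
        by linarith
      then show ?thesis
      proof cases
        case 1
        \<comment> \<open>Either value makes one factor of the excess vanish.\<close>
        then have "?h = 0 \<or> ?h = a + v - 1"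
          using ab d by (auto simp: least_section_def max_def)
        with 1 show ?thesis
          using d e by (auto simp: tent_cases)
      next
        case 2
        then have "?h = a + v - 1"
          using ab d e by (auto simp: least_section_def max_def e_def)
        with 2 show ?thesis
          using d e by (simp add: tent_cases)
      next
        case 3
        then have "?h = d - (b - v)" "1 - a - v + (d - (b - v)) = e"
          using ab d e by (auto simp: least_section_def max_def e_def)
        with 3 show ?thesis
          using d e by (simp add: tent_cases)
      next
        case 4
        then have "?h = d" "1 - a - v + d = e - (v - b)"
          using ab d e by (auto simp: least_section_def max_def e_def)
        with 4 show ?thesis
          using d e by (simp add: tent_cases)
      qed
    qed
    moreover have "0 \<le> ?h" "?h \<le> a" "?h \<le> v" "a + v - 1 \<le> ?h"
      using v ab d by (auto simp: least_section_def)
    ultimately show ?thesis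
      using integral_unique[OF has_integral_glued] v ab by simp
  qed
  have "double_integral (glued a (least_section a b d)) = integral {0..1} (\<lambda>v. v\<^sup>2 / 2 + tent b d e v)"
    unfolding double_integral_def by (intro integral_cong slice)
  also have "\<dots> = 1 / 6 + d * e * (d + e) / 2"
    by (intro integral_unique has_integral_tent_plus d e)
  finally show ?thesis
    by (simp add: e_def)
qed

text \<open>Every copula lies above the symmetric function \<open>max 0 (u + v - 1)\<close>; staying
  within \<open>d\<close> of it limits the asymmetry to \<open>d\<close>.\<close>

lemma least_upper: "glued a (least_section a b d) u v \<le> max 0 (u + v - 1) + d"
proof -
  define h where "h = least_section a b d v"
  have h: "max 0 (a + v - 1) \<le> h" "h \<le> max 0 (a + v - 1) + d"
    using d by (auto simp: h_def least_section_def)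
  have "max 0 (u - (a - h)) - max 0 (u - a) + max 0 (u - (1 - v + h)) \<le> max 0 (u + v - 1) + d"
  proof (cases "a + v \<le> 1")
    case True
    then have "max 0 (a + v - 1) = 0"
      by simp
    with h d show ?thesis
      by (auto simp: max_def)
  next
    case False
    then have "max 0 (a + v - 1) = a + v - 1"
      by simp
    with h d show ?thesis
      by (auto simp: max_def)
  qed
  then show ?thesis
    by (simp add: glued_def h_def)
qed

end

section \<open>Convex combinations and attainment of every value\<close>

definition mix :: "real \<Rightarrow> (real \<Rightarrow> real \<Rightarrow> real) \<Rightarrow> (real \<Rightarrow> real \<Rightarrow> real) \<Rightarrow> real \<Rightarrow> real \<Rightarrow> real" where
  "mix t C D u v = t * C u v + (1 - t) * D u v"

lemma copula_mix:
  assumes "copula C" "copula D" "0 \<le> t" "t \<le> 1"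
  shows "copula (mix t C D)"
  unfolding copula_def
proof (intro conjI ballI impI)
  fix u1 u2 v1 v2 :: real
  assume uv: "u1 \<in> {0..1}" "u2 \<in> {0..1}" "v1 \<in> {0..1}" "v2 \<in> {0..1}" "u1 \<le> u2" "v1 \<le> v2"
  have "0 \<le> t * (C u2 v2 - C u2 v1 - C u1 v2 + C u1 v1) +
      (1 - t) * (D u2 v2 - D u2 v1 - D u1 v2 + D u1 v1)"
    using uv assms by (intro add_nonneg_nonneg mult_nonneg_nonneg copula_rect) auto
  then show "0 \<le> mix t C D u2 v2 - mix t C D u2 v1 - mix t C D u1 v2 + mix t C D u1 v1"
    by (simp add: mix_def algebra_simps)
qed (use assms in \<open>auto simp: mix_def copula_bottom copula_left copula_top copula_right algebra_simps\<close>)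

lemma double_integral_mix:
  assumes "copula C" "copula D"
  shows "double_integral (mix t C D) = t * double_integral C + (1 - t) * double_integral D"
proof -
  have slice: "integral {0..1} (\<lambda>u. mix t C D u v) =
      t * integral {0..1} (\<lambda>u. C u v) + (1 - t) * integral {0..1} (\<lambda>u. D u v)" if "v \<in> {0..1}" for v
    unfolding mix_def
    by (intro integral_unique has_integral_add has_integral_mult_right integrable_integral
        integrable_continuous_real continuous_on_copula_slice assms that)
  have "double_integral (mix t C D) = integral {0..1} (\<lambda>v.
      t * integral {0..1} (\<lambda>u. C u v) + (1 - t) * integral {0..1} (\<lambda>u. D u v))"
    unfolding double_integral_def by (intro integral_cong slice)
  also have "\<dots> = t * double_integral C + (1 - t) * double_integral D"
    unfolding double_integral_def
    by (intro integral_unique has_integral_add has_integral_mult_right integrable_integral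
        integrable_continuous_real continuous_on_slice_integral assms)
  finally show ?thesis .
qed

lemma spearman_rho_attained:
  assumes m: "m \<in> {0..1/3}" and r: "r \<in> {12 * m ^ 3 - 1 .. 1 - 36 * m ^ 3}"
  shows "\<exists>C. copula C \<and> mu_inf C = m \<and> spearman_rho C = r"
proof -
  \<comment> \<open>With \<open>a + b = 1\<close> and \<open>b - a = m\<close>, the value
    \<open>m\<close> at \<open>(a, b)\<close> gives quadrant masses \<open>m\<close> and
    \<open>m\<close>, and at \<open>(a, a)\<close> it gives \<open>m\<close> and
    \<open>2 * m\<close>: the equality cases of the lower and, after \<open>flip\<close>, the upper
    bound.\<close>
  define a where "a = (1 - m) / 2"
  define b where "b = (1 + m) / 2"
  define C where "C = glued a (least_section a b m)"
  define D where "D = glued a (least_section a a m)"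
  \<comment> \<open>\<open>m \<le> a\<close> is exactly \<open>m \<le> 1/3\<close>.\<close>
  have ab: "a \<in> {0..1}" "b \<in> {0..1}" "m \<le> a" "m \<le> b" "a + b = 1" "b - a = m" "0 \<le> m"
    using m by (auto simp: a_def b_def field_simps)
  have C: "copula C" and D: "copula D" and F: "copula (flip D)"
    unfolding C_def D_def using ab by (auto intro!: copula_least copula_flip)
  have eC: "m + 1 - a - b = m" and eD: "m + 1 - a - a = 2 * m"
    using ab by auto
  have iC: "double_integral C = 1 / 6 + m ^ 3"
    unfolding C_def using ab by (subst double_integral_least) (auto simp: eC power3_eq_cube)
  have iD: "double_integral D = 1 / 6 + 3 * m ^ 3"
    unfolding D_def using ab by (subst double_integral_least) (auto simp: eD power3_eq_cube)
  have asym_C: "\<bar>C u v - C v u\<bar> \<le> m" if "u \<in> {0..1}" "v \<in> {0..1}" for u v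
  proof -
    have "C u v \<le> max 0 (u + v - 1) + m" "C v u \<le> max 0 (v + u - 1) + m"
      unfolding C_def using ab by (auto intro!: least_upper)
    then show ?thesis
      using copula_bounds[OF C, of u v] copula_bounds[OF C, of v u] that by (auto simp: max_def split: if_splits)
  qed
  \<comment> \<open>\<open>flip D u v\<close> lies between \<open>min u v - m\<close> and
    \<open>min u v\<close>, both symmetric in \<open>u\<close> and \<open>v\<close>.\<close>
  have asym_F: "\<bar>flip D u v - flip D v u\<bar> \<le> m" if "u \<in> {0..1}" "v \<in> {0..1}" for u v
  proof -
    have "D (1 - u) v \<le> max 0 (1 - u + v - 1) + m" "D (1 - v) u \<le> max 0 (1 - v + u - 1) + m"
      using least_upper[of a a m "1 - u" v] least_upper[of a a m "1 - v" u] ab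
      by (simp_all add: D_def)
    then show ?thesis
      using copula_bounds[OF D, of "1 - u" v] copula_bounds[OF D, of "1 - v" u] that
      by (auto simp: flip_def max_def split: if_splits)
  qed
  have C_ab: "C a b - C b a = m"
    using ab by (auto simp: C_def glued_def least_section_def max_def)
  have "1 - a = b" "1 - b = a"
    using ab by auto
  then have F_ab: "flip D a b - flip D b a = m"
    using ab by (auto simp: flip_def D_def glued_def least_section_def max_def)
  have "m ^ 3 \<le> (1 / 3) ^ 3"
    using m by (intro power_mono) auto
  then have gap: "0 < 2 - 48 * m ^ 3"
    by (simp add: power3_eq_cube)
  \<comment> \<open>The mixture has rho equal to
    \<open>1 - 36 * m ^ 3 - t * (2 - 48 * m ^ 3)\<close>; this weight makes it
    \<open>r\<close>.\<close>
  define t where "t = (1 - 36 * m ^ 3 - r) / (2 - 48 * m ^ 3)"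
  have t: "0 \<le> t" "t \<le> 1" "t * (2 - 48 * m ^ 3) = 1 - 36 * m ^ 3 - r"
    using gap r by (auto simp: t_def)
  have mix: "copula (mix t C (flip D))"
    by (intro copula_mix C F t)
  have diff: "mix t C (flip D) u v - mix t C (flip D) v u =
      t * (C u v - C v u) + (1 - t) * (flip D u v - flip D v u)" for u v
    by (simp add: mix_def algebra_simps)
  have "mu_inf (mix t C (flip D)) = m"
  proof (rule mu_inf_eqI[OF _ ab(1,2)])
    fix u v :: real assume uv: "u \<in> {0..1}" "v \<in> {0..1}"
    have "\<bar>mix t C (flip D) u v - mix t C (flip D) v u\<bar> \<le>
        t * \<bar>C u v - C v u\<bar> + (1 - t) * \<bar>flip D u v - flip D v u\<bar>"
      unfolding diff using t by (intro order_trans[OF abs_triangle_ineq]) (simp add: abs_mult)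
    also have "\<dots> \<le> t * m + (1 - t) * m"
      using t uv by (intro add_mono mult_left_mono asym_C asym_F) auto
    finally show "\<bar>mix t C (flip D) u v - mix t C (flip D) v u\<bar> \<le> m"
      by (simp add: algebra_simps)
  next
    \<comment> \<open>Both differences at \<open>(a, b)\<close> are \<open>m\<close> with the same
      sign, so nothing cancels in the mixture.\<close>
    have "t * m + (1 - t) * m = m"
      by (simp add: algebra_simps)
    then show "\<bar>mix t C (flip D) a b - mix t C (flip D) b a\<bar> = m"
      unfolding diff C_ab F_ab using ab by simp
  qed
  moreover have "spearman_rho (mix t C (flip D)) = r"
    using t(3) by (simp add: spearman_rho_eq[OF mix] double_integral_mix[OF C F] double_integral_flip[OF D]
        iC iD field_simps)
  ultimately show ?thesis
    using mix by blast
qed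

theorem theorem9:
  "(\<forall>C m. copula C \<and> mu_inf C = m \<longrightarrow> spearman_rho C \<in> {12 * m^3 - 1 .. 1 - 36 * m^3}) \<and>
   (\<forall>m\<in>{0..1/3}. \<forall>r\<in>{12 * m^3 - 1 .. 1 - 36 * m^3}.
      \<exists>C. copula C \<and> mu_inf C = m \<and> spearman_rho C = r) \<and>
   (\<forall>r\<in>{-1..1}. \<exists>C. symmetric_copula C \<and> spearman_rho C = r) \<and>
   (\<forall>C. copula C \<and> mu_inf C = 1/3 \<longrightarrow> spearman_rho C \<in> {-5/9 .. -1/3})"
proof (intro conjI allI ballI impI)
  show "spearman_rho C \<in> {12 * m^3 - 1 .. 1 - 36 * m^3}" if "copula C \<and> mu_inf C = m" for C m
    using spearman_rho_bounds[of C] that by auto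
  show "\<exists>C. copula C \<and> mu_inf C = m \<and> spearman_rho C = r"
    if "m \<in> {0..1/3}" "r \<in> {12 * m^3 - 1 .. 1 - 36 * m^3}" for m r
    using that by (rule spearman_rho_attained)
  show "\<exists>C. symmetric_copula C \<and> spearman_rho C = r" if r: "r \<in> {-1..1}" for r
  proof -
    obtain C where C: "copula C" "mu_inf C = 0" "spearman_rho C = r"
      using spearman_rho_attained[of 0 r] r by auto
    then have "symmetric_copula C"
      using mu_inf_upper[OF C(1)] by (simp add: symmetric_copula_def)
    then show ?thesis
      using C(3) by blast
  qed
  show "spearman_rho C \<in> {-5/9 .. -1/3}" if "copula C \<and> mu_inf C = 1/3" for C
    using spearman_rho_bounds[of C] that by (auto simp: power3_eq_cube)
qed

end
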